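(* Let $I$ be a divisor-closed finite set and let $\mathcal K_I:=\{\text{\L}_n^+\mid n\in I\}$. Then the variety $\mathcal V(\mathcal K_I)$ generated by $\mathcal K_I$ is axiomatized by the set of equations $\Phi_{\mathrm{lcm}(I)}\cup\Sigma_I$ relatively to the variety of MV-monoids.
   Context: An MV-monoid is an algebra $\langle A,\vee,\wedge,\oplus,\odot,0,1\rangle$ such that $\langle A,\vee,\wedge,0,1\rangle$ is a bounded distributive lattice, $\langle A,\oplus,0\rangle$ and $\langle A,\odot,1\rangle$ are commutative monoids, $\oplus$ and $\odot$ both distribute over both $\vee$ and $\wedge$, and for all $x,y,z\in A$: $(x\oplus y)\odot((x\odot y)\oplus z)=(x\odot(y\oplus z))\oplus(y\odot z)$; $(x\odot y)\oplus((x\oplus y)\odot z)=(x\oplus(y\odot z))\odot(y\oplus z)$; $(x\odot y)\oplus z=((x\oplus y)\odot((x\odot y)\oplus z))\vee z$; $(x\oplus y)\odot z=((x\odot y)\oplus((x\oplus y)\odot z))\wedge z$. For $n\in\mathbb N\setminus\{0\}$, $\text{\L}_n^+$ is the MV-monoid with universe $\{0,\frac1n,\dots,\frac{n-1}n,1\}$, usual order, $x\oplus y=\min\{x+y,1\}$ and $x\odot y=\max\{x+y-1,0\}$. A divisor-closed finite set is a finite subset $I\subseteq\mathbb N\setminus\{0\}$ such that every positive divisor of an element of $I$ belongs to $I$. Conventions: $\mathrm{lcm}(\emptyset)=1$. In the language of MV-monoids, $nx:=x\oplus\dots\oplus x$ ($n$ times, with $0x=0$) and $x^n:=x\odot\dots\odot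 x$ ($n$ times, with $x^0=1$). For $n\in\mathbb N$ and $k\in\mathbb Z$ the unary term $\tau_{n,k}(x)$ is defined by induction on $n$: $\tau_{0,k}(x):=1$ if $k\le -1$ and $\tau_{0,k}(x):=0$ if $k\ge 0$; $\tau_{n+1,k}(x):=\tau_{n,k-1}(x)\odot(x\oplus\tau_{n,k}(x))$. For $n\in\mathbb N$, $\Phi_n$ is the set of equations $\tau_{n,k}(x)\oplus\tau_{n,k}(x)\approx\tau_{n,k}(x)$ and $\tau_{n,k}(x)\odot\tau_{n,k}(x)\approx\tau_{n,k}(x)$, for $k\in\{0,\dots,n-1\}$. For a divisor-closed finite set $I$, with $m:=\max I$ (and $m:=0$ if $I=\emptyset$), $\Sigma_I$ is the set consisting of the equation $(m+1)x\approx mx$ together with the equations $m((k-1)x)^k\approx(kx)^m$ for all $1\le k\le m$ with $k\notin I$; here $m((k-1)x)^k$ means the $m$-fold $\oplus$-sum of the $k$-th $\odot$-power of $(k-1)x$, and $(kx)^m$ the $m$-th $\odot$-power of $kx$. "Axiomatized by $E$ relatively to the variety of MV-monoids" means: the variety equals the class of all MV-monoids satisfying all equations in $E$. *)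

theory Defs
  imports Complex_Main "HOL-Library.FuncSet" "HOL-Algebra.Group"
begin

section \<open>MV-monoids\<close>

record 'a mv_struct = "'a partial_object" +
  mv_join :: "'a \<Rightarrow> 'a \<Rightarrow> 'a" (infixl "\<curlyvee>\<index>" 65)
  mv_meet :: "'a \<Rightarrow> 'a \<Rightarrow> 'a" (infixl "\<curlywedge>\<index>" 70)
  mv_oplus :: "'a \<Rightarrow> 'a \<Rightarrow> 'a" (infixl "\<oplus>\<index>" 65)
  mv_odot :: "'a \<Rightarrow> 'a \<Rightarrow> 'a" (infixl "\<odot>\<index>" 70)
  mv_zero :: 'a
  mv_one :: 'a

text \<open>Arbitrary algebras of the signature of MV-monoids: the only requirement is that the carrier
  is closed under the operations.  Values of the operations outside the carrier are irrelevant.\<close>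

locale mv_alg =
  fixes A :: "'a mv_struct" (structure)
  assumes zero_closed: "mv_zero A \<in> carrier A"
    and one_closed: "mv_one A \<in> carrier A"
    and join_closed: "\<lbrakk>x \<in> carrier A; y \<in> carrier A\<rbrakk> \<Longrightarrow> x \<curlyvee> y \<in> carrier A"
    and meet_closed: "\<lbrakk>x \<in> carrier A; y \<in> carrier A\<rbrakk> \<Longrightarrow> x \<curlywedge> y \<in> carrier A"
    and oplus_closed: "\<lbrakk>x \<in> carrier A; y \<in> carrier A\<rbrakk> \<Longrightarrow> x \<oplus> y \<in> carrier A"
    and odot_closed: "\<lbrakk>x \<in> carrier A; y \<in> carrier A\<rbrakk> \<Longrightarrow> x \<odot> y \<in> carrier A"

locale mv_bounded_distrib_lattice = mv_alg +
  assumes join_assoc: "\<lbrakk>x \<in> carrier A; y \<in> carrier A; z \<in> carrier A\<rbrakk> \<Longrightarrow>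
      (x \<curlyvee> y) \<curlyvee> z = x \<curlyvee> (y \<curlyvee> z)"
    and meet_assoc: "\<lbrakk>x \<in> carrier A; y \<in> carrier A; z \<in> carrier A\<rbrakk> \<Longrightarrow>
      (x \<curlywedge> y) \<curlywedge> z = x \<curlywedge> (y \<curlywedge> z)"
    and join_comm: "\<lbrakk>x \<in> carrier A; y \<in> carrier A\<rbrakk> \<Longrightarrow> x \<curlyvee> y = y \<curlyvee> x"
    and meet_comm: "\<lbrakk>x \<in> carrier A; y \<in> carrier A\<rbrakk> \<Longrightarrow> x \<curlywedge> y = y \<curlywedge> x"
    and join_absorb: "\<lbrakk>x \<in> carrier A; y \<in> carrier A\<rbrakk> \<Longrightarrow> x \<curlyvee> (x \<curlywedge> y) = x"
    and meet_absorb: "\<lbrakk>x \<in> carrier A; y \<in> carrier A\<rbrakk> \<Longrightarrow> x \<curlywedge> (x \<curlyvee> y) = x"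
    and meet_join_distrib: "\<lbrakk>x \<in> carrier A; y \<in> carrier A; z \<in> carrier A\<rbrakk> \<Longrightarrow>
      x \<curlywedge> (y \<curlyvee> z) = (x \<curlywedge> y) \<curlyvee> (x \<curlywedge> z)"
    and join_zero: "x \<in> carrier A \<Longrightarrow> x \<curlyvee> mv_zero A = x"
    and meet_one: "x \<in> carrier A \<Longrightarrow> x \<curlywedge> mv_one A = x"

locale mv_monoid = mv_bounded_distrib_lattice +
  assumes oplus_comm_monoid:
      "comm_monoid \<lparr>carrier = carrier A, mult = mv_oplus A, one = mv_zero A\<rparr>"
    and odot_comm_monoid:
      "comm_monoid \<lparr>carrier = carrier A, mult = mv_odot A, one = mv_one A\<rparr>"
    and oplus_join_distrib: "\<lbrakk>x \<in> carrier A; y \<in> carrier A; z \<in> carrier A\<rbrakk> \<Longrightarrow>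
      x \<oplus> (y \<curlyvee> z) = (x \<oplus> y) \<curlyvee> (x \<oplus> z)"
    and oplus_meet_distrib: "\<lbrakk>x \<in> carrier A; y \<in> carrier A; z \<in> carrier A\<rbrakk> \<Longrightarrow>
      x \<oplus> (y \<curlywedge> z) = (x \<oplus> y) \<curlywedge> (x \<oplus> z)"
    and odot_join_distrib: "\<lbrakk>x \<in> carrier A; y \<in> carrier A; z \<in> carrier A\<rbrakk> \<Longrightarrow>
      x \<odot> (y \<curlyvee> z) = (x \<odot> y) \<curlyvee> (x \<odot> z)"
    and odot_meet_distrib: "\<lbrakk>x \<in> carrier A; y \<in> carrier A; z \<in> carrier A\<rbrakk> \<Longrightarrow>
      x \<odot> (y \<curlywedge> z) = (x \<odot> y) \<curlywedge> (x \<odot> z)"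
    and mv_ax1: "\<lbrakk>x \<in> carrier A; y \<in> carrier A; z \<in> carrier A\<rbrakk> \<Longrightarrow>
      (x \<oplus> y) \<odot> ((x \<odot> y) \<oplus> z) = (x \<odot> (y \<oplus> z)) \<oplus> (y \<odot> z)"
    and mv_ax2: "\<lbrakk>x \<in> carrier A; y \<in> carrier A; z \<in> carrier A\<rbrakk> \<Longrightarrow>
      (x \<odot> y) \<oplus> ((x \<oplus> y) \<odot> z) = (x \<oplus> (y \<odot> z)) \<odot> (y \<oplus> z)"
    and mv_ax3: "\<lbrakk>x \<in> carrier A; y \<in> carrier A; z \<in> carrier A\<rbrakk> \<Longrightarrow>
      (x \<odot> y) \<oplus> z = ((x \<oplus> y) \<odot> ((x \<odot> y) \<oplus> z)) \<curlyvee> z"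
    and mv_ax4: "\<lbrakk>x \<in> carrier A; y \<in> carrier A; z \<in> carrier A\<rbrakk> \<Longrightarrow>
      (x \<oplus> y) \<odot> z = ((x \<odot> y) \<oplus> ((x \<oplus> y) \<odot> z)) \<curlywedge> z"

definition L_plus :: "nat \<Rightarrow> rat mv_struct" where
  "L_plus n =
    \<lparr>carrier = {of_nat i / of_nat n | i. i \<le> n},
     mv_join = max, mv_meet = min,
     mv_oplus = (\<lambda>x y. min (x + y) 1), mv_odot = (\<lambda>x y. max (x + y - 1) 0),
     mv_zero = 0, mv_one = 1\<rparr>"


section \<open>Terms and equations\<close>

datatype 'v mv_term =
    Var 'v
  | Zero
  | One
  | Join "'v mv_term" "'v mv_term"
  | Meet "'v mv_term" "'v mv_term"
  | Oplus "'v mv_term" "'v mv_term"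
  | Odot "'v mv_term" "'v mv_term"

primrec mv_eval :: "'a mv_struct \<Rightarrow> ('v \<Rightarrow> 'a) \<Rightarrow> 'v mv_term \<Rightarrow> 'a" where
  "mv_eval A v (Var x) = v x"
| "mv_eval A v Zero = mv_zero A"
| "mv_eval A v One = mv_one A"
| "mv_eval A v (Join s t) = mv_join A (mv_eval A v s) (mv_eval A v t)"
| "mv_eval A v (Meet s t) = mv_meet A (mv_eval A v s) (mv_eval A v t)"
| "mv_eval A v (Oplus s t) = mv_oplus A (mv_eval A v s) (mv_eval A v t)"
| "mv_eval A v (Odot s t) = mv_odot A (mv_eval A v s) (mv_eval A v t)"

type_synonym mv_equation = "nat mv_term \<times> nat mv_term"

definition mv_satisfies :: "'a mv_struct \<Rightarrow> mv_equation \<Rightarrow> bool" where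
  "mv_satisfies A e \<longleftrightarrow>
    (\<forall>v. range v \<subseteq> carrier A \<longrightarrow> mv_eval A v (fst e) = mv_eval A v (snd e))"


section \<open>The variety generated by a class of algebras\<close>

definition mv_hom :: "'a mv_struct \<Rightarrow> 'b mv_struct \<Rightarrow> ('a \<Rightarrow> 'b) set" where
  "mv_hom A B = {h \<in> carrier A \<rightarrow> carrier B.
     h (mv_zero A) = mv_zero B \<and> h (mv_one A) = mv_one B \<and>
     (\<forall>x\<in>carrier A. \<forall>y\<in>carrier A.
        h (mv_join A x y) = mv_join B (h x) (h y) \<and>
        h (mv_meet A x y) = mv_meet B (h x) (h y) \<and>
        h (mv_oplus A x y) = mv_oplus B (h x) (h y) \<and>
        h (mv_odot A x y) = mv_odot B (h x) (h y))}"

definition mv_product :: "'j set \<Rightarrow> ('j \<Rightarrow> 'b mv_struct) \<Rightarrow> ('j \<Rightarrow> 'b) mv_struct" where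
  "mv_product J B =
    \<lparr>carrier = (\<Pi>\<^sub>E j\<in>J. carrier (B j)),
     mv_join = (\<lambda>f g. \<lambda>j\<in>J. mv_join (B j) (f j) (g j)),
     mv_meet = (\<lambda>f g. \<lambda>j\<in>J. mv_meet (B j) (f j) (g j)),
     mv_oplus = (\<lambda>f g. \<lambda>j\<in>J. mv_oplus (B j) (f j) (g j)),
     mv_odot = (\<lambda>f g. \<lambda>j\<in>J. mv_odot (B j) (f j) (g j)),
     mv_zero = (\<lambda>j\<in>J. mv_zero (B j)),
     mv_one = (\<lambda>j\<in>J. mv_one (B j))\<rparr>"

definition products_of :: "'b mv_struct set \<Rightarrow> ('j \<Rightarrow> 'b) mv_struct set" where
  "products_of K = {mv_product J B | J B. \<forall>j\<in>J. B j \<in> K}"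

definition subalgebras_of :: "'b mv_struct set \<Rightarrow> 'b mv_struct set" where
  "subalgebras_of K = {B\<lparr>carrier := S\<rparr> | B S.
     B \<in> K \<and> S \<subseteq> carrier B \<and> mv_alg (B\<lparr>carrier := S\<rparr>)}"

definition hom_images_of :: "'b mv_struct set \<Rightarrow> 'a mv_struct set" where
  "hom_images_of K = {A. \<exists>B\<in>K. \<exists>h\<in>mv_hom B A. h ` carrier B = carrier A}"

text \<open>The variety generated by \<open>K\<close> is the class of homomorphic images of subalgebras of products
  of members of \<open>K\<close>, here restricted to the algebras with carrier in a given type \<open>'a\<close>.  HOL
  cannot quantify over the type of the indices of the products, so it is fixed to be
  \<open>('a \<Rightarrow> 'b) \<times> 'b mv_struct\<close>. This loses nothing: products over any other index type give no
  further algebras (lemma \<open>HSP_subset_generated_variety\<close>), and the result is the class of all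
  algebras that satisfy the equational theory of \<open>K\<close> (lemma \<open>generated_variety_eq_Mod_Th\<close>).\<close>

definition generated_variety :: "'b mv_struct set \<Rightarrow> 'a mv_struct set" where
  "generated_variety K = hom_images_of (subalgebras_of
     (products_of K :: (('a \<Rightarrow> 'b) \<times> 'b mv_struct \<Rightarrow> 'b) mv_struct set))"

lemma products_ofE:
  assumes "P \<in> products_of K"
  obtains J B where "P = mv_product J B" "\<And>j. j \<in> J \<Longrightarrow> B j \<in> K"
  using assms unfolding products_of_def by blast

lemma subalgebras_ofE:
  assumes "C \<in> subalgebras_of K"
  obtains B S where "C = B\<lparr>carrier := S\<rparr>" "B \<in> K" "S \<subseteq> carrier B" "mv_alg (B\<lparr>carrier := S\<rparr>)"
  using assms unfolding subalgebras_of_def by blast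

lemma hom_images_ofE:
  assumes "A \<in> hom_images_of K"
  obtains B h where "B \<in> K" "h \<in> mv_hom B A" "h ` carrier B = carrier A"
  using assms unfolding hom_images_of_def by blast

lemma mv_eval_closed:
  assumes "mv_alg A" "v ` set_mv_term t \<subseteq> carrier A"
  shows "mv_eval A v t \<in> carrier A"
proof -
  interpret mv_alg A by fact
  show ?thesis
    using assms(2)
    by (induction t)
      (auto intro: zero_closed one_closed join_closed meet_closed oplus_closed odot_closed)
qed

lemma mv_eval_map: "mv_eval A v (map_mv_term r t) = mv_eval A (v \<circ> r) t"
  by (induction t) auto

lemma mv_eval_cong: "(\<And>x. x \<in> set_mv_term t \<Longrightarrow> v x = w x) \<Longrightarrow> mv_eval A v t = mv_eval A w t"
  by (induction t) auto

lemma mv_eval_hom: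
  assumes "mv_alg A" "h \<in> mv_hom A B" "v ` set_mv_term t \<subseteq> carrier A"
  shows "h (mv_eval A v t) = mv_eval B (h \<circ> v) t"
  using assms(3) by (induction t) (use assms(1,2) in \<open>auto simp: mv_hom_def image_Un mv_eval_closed\<close>)

lemma mv_eval_carrier_update: "mv_eval (B\<lparr>carrier := S\<rparr>) v t = mv_eval B v t"
  by (induction t) auto

lemma mv_eval_product:
  "j \<in> J \<Longrightarrow> mv_eval (mv_product J B) v t j = mv_eval (B j) (\<lambda>x. v x j) t"
  by (induction t) (auto simp: mv_product_def)

lemma HSP_satisfies:
  fixes A :: "'a mv_struct" and K :: "'b mv_struct set"
  assumes A: "A \<in> hom_images_of (subalgebras_of (products_of K :: ('j \<Rightarrow> 'b) mv_struct set))"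
    and K: "\<And>B. B \<in> K \<Longrightarrow> mv_satisfies B e"
  shows "mv_satisfies A e"
proof -
  from A obtain C h where C: "C \<in> subalgebras_of (products_of K :: ('j \<Rightarrow> 'b) mv_struct set)"
    and hC: "h \<in> mv_hom C A" "h ` carrier C = carrier A"
    by (rule hom_images_ofE)
  from C obtain D S where D: "C = D\<lparr>carrier := S\<rparr>" "D \<in> products_of K" "S \<subseteq> carrier D"
    "mv_alg (D\<lparr>carrier := S\<rparr>)" by (rule subalgebras_ofE)
  from D(2) obtain J B where DB: "D = mv_product J B" and B: "\<And>j. j \<in> J \<Longrightarrow> B j \<in> K"
    by (rule products_ofE) blast
  have S: "S \<subseteq> carrier (mv_product J B)" "mv_alg ((mv_product J B)\<lparr>carrier := S\<rparr>)"
    and h: "h \<in> mv_hom ((mv_product J B)\<lparr>carrier := S\<rparr>) A" "h ` S = carrier A"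
    using D hC DB by simp_all
  let ?P = "(mv_product J B)\<lparr>carrier := S\<rparr>"
  show ?thesis
    unfolding mv_satisfies_def
  proof (intro allI impI)
    fix v :: "nat \<Rightarrow> 'a" assume v: "range v \<subseteq> carrier A"
    define w where "w n = (SOME s. s \<in> S \<and> h s = v n)" for n
    have w: "w n \<in> S \<and> h (w n) = v n" for n
    proof -
      have "\<exists>s. s \<in> S \<and> h s = v n" using v h(2) by (metis imageE range_subsetD)
      then show ?thesis unfolding w_def by (rule someI_ex)
    qed
    have closed: "mv_eval ?P w t \<in> carrier (mv_product J B)" for t
      using mv_eval_closed[OF S(2), of w t] w S(1) by auto
    have pt: "mv_eval ?P w (fst e) j = mv_eval ?P w (snd e) j" if j: "j \<in> J" for j
    proof -
      have "w n j \<in> carrier (B j)" for n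
        using w[of n] S(1) j by (auto simp: mv_product_def)
      then have "range (\<lambda>n. w n j) \<subseteq> carrier (B j)" by blast
      then show ?thesis
        using K[OF B[OF j]] j
        by (auto simp: mv_satisfies_def mv_eval_carrier_update mv_eval_product)
    qed
    have "mv_eval ?P w (fst e) = mv_eval ?P w (snd e)"
    proof (rule PiE_ext)
      show "mv_eval ?P w (fst e) \<in> (\<Pi>\<^sub>E j\<in>J. carrier (B j))"
        "mv_eval ?P w (snd e) \<in> (\<Pi>\<^sub>E j\<in>J. carrier (B j))"
        using closed by (simp_all add: mv_product_def)
    qed (use pt in auto)
    moreover have "h (mv_eval ?P w t) = mv_eval A v t" for t
    proof -
      have "h \<circ> w = v" using w by auto
      then show ?thesis using mv_eval_hom[OF S(2) h(1), of w t] w by auto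
    qed
    ultimately show "mv_eval A v (fst e) = mv_eval A v (snd e)" by metis
  qed
qed

lemma HSP_mv_alg:
  assumes "A \<in> hom_images_of (subalgebras_of K)"
  shows "mv_alg A"
proof -
  from assms obtain B h where BS: "B \<in> subalgebras_of K"
    and h: "h \<in> mv_hom B A" "h ` carrier B = carrier A"
    by (rule hom_images_ofE)
  from BS have B: "mv_alg B" by (rule subalgebras_ofE) simp
  interpret B: mv_alg B by fact
  have hom: "h (mv_zero B) = mv_zero A" "h (mv_one B) = mv_one A"
    "\<And>x y. x \<in> carrier B \<Longrightarrow> y \<in> carrier B \<Longrightarrow> h (mv_join B x y) = mv_join A (h x) (h y)"
    "\<And>x y. x \<in> carrier B \<Longrightarrow> y \<in> carrier B \<Longrightarrow> h (mv_meet B x y) = mv_meet A (h x) (h y)"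
    "\<And>x y. x \<in> carrier B \<Longrightarrow> y \<in> carrier B \<Longrightarrow> h (mv_oplus B x y) = mv_oplus A (h x) (h y)"
    "\<And>x y. x \<in> carrier B \<Longrightarrow> y \<in> carrier B \<Longrightarrow> h (mv_odot B x y) = mv_odot A (h x) (h y)"
    using h(1) unfolding mv_hom_def by blast+
  show ?thesis
  proof
    have "h (mv_zero B) \<in> h ` carrier B" "h (mv_one B) \<in> h ` carrier B"
      using B.zero_closed B.one_closed by blast+
    then show "mv_zero A \<in> carrier A" "mv_one A \<in> carrier A"
      using hom(1,2) h(2) by metis+
  next
    fix x y assume "x \<in> carrier A" "y \<in> carrier A"
    then obtain a b where ab: "a \<in> carrier B" "b \<in> carrier B" "x = h a" "y = h b"
      using h(2) by blast
    have "h (mv_join B a b) \<in> h ` carrier B" "h (mv_meet B a b) \<in> h ` carrier B"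
      "h (mv_oplus B a b) \<in> h ` carrier B" "h (mv_odot B a b) \<in> h ` carrier B"
      by (intro imageI B.join_closed B.meet_closed B.oplus_closed B.odot_closed ab(1,2))+
    then show "mv_join A x y \<in> carrier A" "mv_meet A x y \<in> carrier A"
      "mv_oplus A x y \<in> carrier A" "mv_odot A x y \<in> carrier A"
      unfolding ab(3,4) using hom(3-6)[OF ab(1,2)] h(2) by metis+
  qed
qed

lemma satisfies_rename:
  fixes s t :: "'v mv_term" and A :: "'a mv_struct" and K :: "'b mv_struct set"
  assumes sat: "\<And>e. (\<And>B. B \<in> K \<Longrightarrow> mv_satisfies B e) \<Longrightarrow> mv_satisfies A e"
    and K: "\<And>B v. B \<in> K \<Longrightarrow> range v \<subseteq> carrier B \<Longrightarrow> mv_eval B v s = mv_eval B v t"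
    and alg: "\<And>B. B \<in> K \<Longrightarrow> mv_alg B" "mv_alg A"
    and w: "w ` (set_mv_term s \<union> set_mv_term t) \<subseteq> carrier A"
  shows "mv_eval A w s = mv_eval A w t"
proof -
  define V where "V = set_mv_term s \<union> set_mv_term t"
  have "finite (set_mv_term u)" for u :: "'v mv_term" by (induction u) auto
  then have "finite V" by (simp add: V_def)
  then obtain r :: "'v \<Rightarrow> nat" where r: "inj_on r V"
    using finite_imp_inj_to_nat_seg by metis
  have "mv_satisfies A (map_mv_term r s, map_mv_term r t)"
  proof (rule sat)
    fix B :: "'b mv_struct" assume B: "B \<in> K"
    show "mv_satisfies B (map_mv_term r s, map_mv_term r t)"
      unfolding mv_satisfies_def
    proof (intro allI impI)
      fix v :: "nat \<Rightarrow> 'b" assume "range v \<subseteq> carrier B"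
      then have "range (v \<circ> r) \<subseteq> carrier B" by auto
      then show "mv_eval B v (fst (map_mv_term r s, map_mv_term r t)) =
          mv_eval B v (snd (map_mv_term r s, map_mv_term r t))"
        using K[OF B] by (simp add: mv_eval_map)
    qed
  qed
  moreover define v where "v n = (if n \<in> r ` V then w (inv_into V r n) else mv_zero A)" for n
  moreover have "range v \<subseteq> carrier A"
    using w mv_alg.zero_closed[OF alg(2)] r by (auto simp: v_def V_def[symmetric])
  ultimately have "mv_eval A (v \<circ> r) s = mv_eval A (v \<circ> r) t"
    unfolding mv_satisfies_def by (simp add: mv_eval_map)
  moreover have "mv_eval A (v \<circ> r) s = mv_eval A w s" "mv_eval A (v \<circ> r) t = mv_eval A w t"
    by (rule mv_eval_cong; use r in \<open>auto simp: v_def V_def\<close>)+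
  ultimately show ?thesis by simp
qed

lemma generated_variety_eq_Mod_Th:
  fixes K :: "'b mv_struct set"
  assumes K: "\<And>B. B \<in> K \<Longrightarrow> mv_alg B"
  shows "(generated_variety K :: 'a mv_struct set) =
    {A. mv_alg A \<and> (\<forall>e. (\<forall>B\<in>K. mv_satisfies B e) \<longrightarrow> mv_satisfies A e)}"
proof (intro equalityI subsetI CollectI conjI allI impI)
  fix A :: "'a mv_struct" and e
  assume A: "A \<in> generated_variety K"
  show "mv_alg A" using A unfolding generated_variety_def by (rule HSP_mv_alg)
  show "mv_satisfies A e" if "\<forall>B\<in>K. mv_satisfies B e"
    using A that unfolding generated_variety_def by (auto intro: HSP_satisfies)
next
  fix A :: "'a mv_struct"
  assume "A \<in> {A. mv_alg A \<and> (\<forall>e. (\<forall>B\<in>K. mv_satisfies B e) \<longrightarrow> mv_satisfies A e)}"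
  then have A: "mv_alg A"
    and sat: "\<And>e. (\<And>B. B \<in> K \<Longrightarrow> mv_satisfies B e) \<Longrightarrow> mv_satisfies A e" by blast+
  define J where "J = {(f, B). B \<in> K \<and> f \<in> carrier A \<rightarrow> carrier B}"
  define P where "P = mv_product J (snd :: ('a \<Rightarrow> 'b) \<times> 'b mv_struct \<Rightarrow> 'b mv_struct)"
  define T where "T = {t. set_mv_term t \<subseteq> carrier A}"
  define E where "E t = (\<lambda>j\<in>J. mv_eval (snd j) (fst j) t)" for t
  define S where "S = E ` T"
  define h where "h s = mv_eval A id (SOME t. t \<in> T \<and> E t = s)" for s
  have hE: "h (E t) = mv_eval A id t" if t: "t \<in> T" for t
  proof -
    define u where "u = (SOME u. u \<in> T \<and> E u = E t)"
    have u: "u \<in> T" "E u = E t"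
      using someI[of "\<lambda>u. u \<in> T \<and> E u = E t" t] t by (auto simp: u_def)
    have "mv_eval A id u = mv_eval A id t"
    proof (rule satisfies_rename[OF sat])
      fix B :: "'b mv_struct" and v :: "'a \<Rightarrow> 'b" assume "B \<in> K" "range v \<subseteq> carrier B"
      then have "(v, B) \<in> J" by (auto simp: J_def)
      then show "mv_eval B v u = mv_eval B v t"
        using fun_cong[OF u(2), of "(v, B)"] by (simp add: E_def)
    qed (use K A u t in \<open>auto simp: T_def\<close>)
    then show ?thesis by (simp add: h_def u_def)
  qed
  have ops: "mv_zero P = E Zero" "mv_one P = E One"
    "mv_join P (E s) (E t) = E (Join s t)" "mv_meet P (E s) (E t) = E (Meet s t)"
    "mv_oplus P (E s) (E t) = E (Oplus s t)" "mv_odot P (E s) (E t) = E (Odot s t)" for s t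
    by (auto simp: P_def mv_product_def E_def fun_eq_iff)
  have T: "Zero \<in> T" "One \<in> T" "s \<in> T \<Longrightarrow> t \<in> T \<Longrightarrow> Join s t \<in> T"
    "s \<in> T \<Longrightarrow> t \<in> T \<Longrightarrow> Meet s t \<in> T" "s \<in> T \<Longrightarrow> t \<in> T \<Longrightarrow> Oplus s t \<in> T"
    "s \<in> T \<Longrightarrow> t \<in> T \<Longrightarrow> Odot s t \<in> T" "a \<in> carrier A \<Longrightarrow> Var a \<in> T" for s t a
    by (auto simp: T_def)
  have 1: "P \<in> products_of K"
    unfolding products_of_def P_def J_def by force
  have 2: "S \<subseteq> carrier P"
  proof -
    have "mv_eval (snd j) (fst j) t \<in> carrier (snd j)" if "t \<in> T" "j \<in> J" for t j
      by (rule mv_eval_closed) (use that K in \<open>auto simp: J_def T_def\<close>)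
    then show ?thesis by (auto simp: S_def E_def P_def mv_product_def)
  qed
  have 3: "mv_alg (P\<lparr>carrier := S\<rparr>)"
    by unfold_locales (auto simp: S_def ops T)
  have hT: "mv_eval A id t \<in> carrier A" if "t \<in> T" for t
    by (rule mv_eval_closed) (use that A in \<open>auto simp: T_def\<close>)
  have 4: "h \<in> mv_hom (P\<lparr>carrier := S\<rparr>) A"
    by (auto simp: mv_hom_def S_def ops T hE hT)
  have 5: "h ` S = carrier A"
  proof
    show "h ` S \<subseteq> carrier A" by (auto simp: S_def hE hT)
    show "carrier A \<subseteq> h ` S"
    proof
      fix a assume "a \<in> carrier A"
      then have t: "Var a \<in> T" by (rule T)
      then have "h (E (Var a)) = a" by (simp add: hE)
      with t show "a \<in> h ` S" unfolding S_def by (metis imageI)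
    qed
  qed
  have "P\<lparr>carrier := S\<rparr> \<in> subalgebras_of (products_of K)"
    unfolding subalgebras_of_def using 1 2 3 by blast
  then show "A \<in> generated_variety K"
    unfolding generated_variety_def hom_images_of_def using 4 5 by force
qed

lemma HSP_subset_generated_variety:
  assumes "\<And>B. B \<in> K \<Longrightarrow> mv_alg B"
  shows "hom_images_of (subalgebras_of (products_of K :: ('j \<Rightarrow> 'b) mv_struct set))
    \<subseteq> (generated_variety K :: 'a mv_struct set)"
proof
  fix A :: "'a mv_struct"
  assume A: "A \<in> hom_images_of (subalgebras_of (products_of K :: ('j \<Rightarrow> 'b) mv_struct set))"
  then have "mv_alg A" by (rule HSP_mv_alg)
  moreover have "mv_satisfies A e" if "\<forall>B\<in>K. mv_satisfies B e" for e
    using A that by (auto intro: HSP_satisfies)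
  ultimately show "A \<in> generated_variety K"
    using generated_variety_eq_Mod_Th[OF assms] by blast
qed


section \<open>The axiomatization\<close>

definition divisor_closed_finite :: "nat set \<Rightarrow> bool" where
  "divisor_closed_finite I \<longleftrightarrow>
    finite I \<and> 0 \<notin> I \<and> (\<forall>n\<in>I. \<forall>d. d dvd n \<longrightarrow> d \<in> I)"

definition K_class :: "nat set \<Rightarrow> rat mv_struct set" where
  "K_class I = L_plus ` I"

text \<open>\<open>n x\<close> and \<open>x\<^sup>n\<close> in the language of MV-monoids; the case distinction avoids a
  spurious neutral element, so that \<open>1 x\<close> and \<open>x\<^sup>1\<close> are literally \<open>x\<close>.\<close>

primrec mv_times :: "nat \<Rightarrow> 'v mv_term \<Rightarrow> 'v mv_term" where
  "mv_times 0 x = Zero"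
| "mv_times (Suc n) x = (if n = 0 then x else Oplus (mv_times n x) x)"

primrec mv_power :: "'v mv_term \<Rightarrow> nat \<Rightarrow> 'v mv_term" where
  "mv_power x 0 = One"
| "mv_power x (Suc n) = (if n = 0 then x else Odot (mv_power x n) x)"

primrec tau :: "nat \<Rightarrow> int \<Rightarrow> 'v mv_term \<Rightarrow> 'v mv_term" where
  "tau 0 k x = (if k \<le> -1 then One else Zero)"
| "tau (Suc n) k x = Odot (tau n (k - 1) x) (Oplus x (tau n k x))"

definition Phi :: "nat \<Rightarrow> mv_equation set" where
  "Phi n =
    (\<Union>k\<in>{k::int. 0 \<le> k \<and> k \<le> int n - 1}. let t = tau n k (Var 0) in
       {(Oplus t t, t), (Odot t t, t)})"

definition Sigma_eqs :: "nat set \<Rightarrow> mv_equation set" where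
  "Sigma_eqs I =
    (let m = (if I = {} then 0 else Max I); x = Var 0 in
       {(mv_times (m + 1) x, mv_times m x)} \<union>
       {(mv_times m (mv_power (mv_times (k - 1) x) k), mv_power (mv_times k x) m) | k.
          1 \<le> k \<and> k \<le> m \<and> k \<notin> I})"

end

theory Submission
  imports Defs
begin

text \<open>Being an MV-monoid is equational, so the variety consists of the algebras that satisfy every
  equation valid in all chains of the class.  If such an equation failed in an MV-monoid satisfying
  \<open>\<Phi>\<close> and \<open>\<Sigma>\<close>, a congruence maximal among those separating the two sides would give a quotient in
  which it still fails and in which \<open>0\<close> and \<open>1\<close> are the only elements idempotent for both
  operations, since an idempotent \<open>e\<close> yields the congruences \<open>e \<or> x = e \<or> y\<close> and
  \<open>e \<and> x = e \<and> y\<close>, whose intersection is trivial.  There the equations \<open>\<Phi>\<close> force the threshold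
  terms to take the values \<open>0\<close> and \<open>1\<close>, and the jump between them provides a complement of every
  element.  With complements and \<open>(m + 1) x = m x\<close>, every nonzero \<open>x\<close> has \<open>m x = 1\<close>; the quotient is
  then a chain consisting of the multiples of an atom, that is, a chain \<open>L_plus d\<close>, and \<open>\<Sigma>\<close> forces
  \<open>d \<in> I\<close>.\<close>

section \<open>Equational classes\<close>

text \<open>A valuation in \<open>B\<close> lifts pointwise to one in \<open>A\<close>. This serves
  for quotients and for carrying \<open>Sigma_eqs\<close> to \<open>L_plus d\<close>.\<close>

lemma mv_satisfies_surj_hom:
  assumes "mv_alg A" "h \<in> mv_hom A B" "h ` carrier A = carrier B" "mv_satisfies A e"
  shows "mv_satisfies B e"
  unfolding mv_satisfies_def
proof (intro allI impI)
  fix v :: "nat \<Rightarrow> _" assume "range v \<subseteq> carrier B"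
  then have "\<forall>n. \<exists>s. s \<in> carrier A \<and> h s = v n"
    using assms(3) by (metis imageE range_subsetD)
  then obtain w where w: "\<And>n. w n \<in> carrier A \<and> h (w n) = v n" by metis
  then have "h \<circ> w = v" "range w \<subseteq> carrier A" by auto
  then show "mv_eval B v (fst e) = mv_eval B v (snd e)"
    using assms(4) mv_eval_hom[OF assms(1,2), of w] by (metis image_subsetI mv_satisfies_def w)
qed

lemma mv_satisfies_inj_hom:
  assumes "mv_alg A" "h \<in> mv_hom A B" "inj_on h (carrier A)" "mv_satisfies B e"
  shows "mv_satisfies A e"
  unfolding mv_satisfies_def
proof (intro allI impI)
  fix v :: "nat \<Rightarrow> _" assume v: "range v \<subseteq> carrier A"
  then have sub: "v ` set_mv_term t \<subseteq> carrier A" for t by auto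
  have "range (h \<circ> v) \<subseteq> carrier B" using v assms(2) by (auto simp: mv_hom_def)
  then have "h (mv_eval A v (fst e)) = h (mv_eval A v (snd e))"
    using assms(4) mv_eval_hom[OF assms(1,2) sub] by (simp add: mv_satisfies_def)
  then show "mv_eval A v (fst e) = mv_eval A v (snd e)"
    using assms(3) mv_eval_closed[OF assms(1) sub] by (simp add: inj_on_def)
qed

text \<open>With the axioms as explicit equations, they pass to quotients and from the chains to the
  generated variety.\<close>

definition mv_monoid_eqs :: "mv_equation set" where
  "mv_monoid_eqs = (let x = Var 0; y = Var 1; z = Var 2 in
    {(Join (Join x y) z, Join x (Join y z)), (Meet (Meet x y) z, Meet x (Meet y z)),
     (Join x y, Join y x), (Meet x y, Meet y x),
     (Join x (Meet x y), x), (Meet x (Join x y), x),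
     (Meet x (Join y z), Join (Meet x y) (Meet x z)),
     (Join x Zero, x), (Meet x One, x),
     (Oplus (Oplus x y) z, Oplus x (Oplus y z)), (Oplus x y, Oplus y x), (Oplus x Zero, x),
     (Odot (Odot x y) z, Odot x (Odot y z)), (Odot x y, Odot y x), (Odot x One, x),
     (Oplus x (Join y z), Join (Oplus x y) (Oplus x z)),
     (Oplus x (Meet y z), Meet (Oplus x y) (Oplus x z)),
     (Odot x (Join y z), Join (Odot x y) (Odot x z)),
     (Odot x (Meet y z), Meet (Odot x y) (Odot x z)),
     (Odot (Oplus x y) (Oplus (Odot x y) z), Oplus (Odot x (Oplus y z)) (Odot y z)),
     (Oplus (Odot x y) (Odot (Oplus x y) z), Odot (Oplus x (Odot y z)) (Oplus y z)),
     (Oplus (Odot x y) z, Join (Odot (Oplus x y) (Oplus (Odot x y) z)) z),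
     (Odot (Oplus x y) z, Meet (Oplus (Odot x y) (Odot (Oplus x y) z)) z)})"

context mv_monoid
begin

lemmas closed [simp] = zero_closed one_closed join_closed meet_closed oplus_closed odot_closed

lemma oplus_assoc: "\<lbrakk>x \<in> carrier A; y \<in> carrier A; z \<in> carrier A\<rbrakk> \<Longrightarrow> (x \<oplus> y) \<oplus> z = x \<oplus> (y \<oplus> z)"
  and oplus_comm: "\<lbrakk>x \<in> carrier A; y \<in> carrier A\<rbrakk> \<Longrightarrow> x \<oplus> y = y \<oplus> x"
  and oplus_zero: "x \<in> carrier A \<Longrightarrow> x \<oplus> mv_zero A = x"
  using comm_monoid.m_ac(1)[OF oplus_comm_monoid] comm_monoid.m_comm[OF oplus_comm_monoid]
    monoid.r_one[OF comm_monoid.axioms(1)[OF oplus_comm_monoid]] by auto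

lemma odot_assoc: "\<lbrakk>x \<in> carrier A; y \<in> carrier A; z \<in> carrier A\<rbrakk> \<Longrightarrow> (x \<odot> y) \<odot> z = x \<odot> (y \<odot> z)"
  and odot_comm: "\<lbrakk>x \<in> carrier A; y \<in> carrier A\<rbrakk> \<Longrightarrow> x \<odot> y = y \<odot> x"
  and odot_one: "x \<in> carrier A \<Longrightarrow> x \<odot> mv_one A = x"
  using comm_monoid.m_ac(1)[OF odot_comm_monoid] comm_monoid.m_comm[OF odot_comm_monoid]
    monoid.r_one[OF comm_monoid.axioms(1)[OF odot_comm_monoid]] by auto

lemma satisfies_mv_monoid_eqs:
  assumes "e \<in> mv_monoid_eqs"
  shows "mv_satisfies A e"
  unfolding mv_satisfies_def
proof (intro allI impI)
  fix v :: "nat \<Rightarrow> 'a" assume "range v \<subseteq> carrier A"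
  then have v: "v n \<in> carrier A" for n by auto
  show "mv_eval A v (fst e) = mv_eval A v (snd e)"
    using assms unfolding mv_monoid_eqs_def Let_def
    apply (elim insertE emptyE)
    apply (simp_all only: fst_conv snd_conv mv_eval.simps)
    by (rule join_assoc meet_assoc join_comm meet_comm join_absorb meet_absorb meet_join_distrib
      join_zero meet_one oplus_assoc oplus_comm oplus_zero odot_assoc odot_comm odot_one
      oplus_join_distrib oplus_meet_distrib odot_join_distrib odot_meet_distrib
      mv_ax1 mv_ax2 mv_ax3 mv_ax4; rule v)+
qed

end

lemma mv_monoid_iff_eqs:
  "mv_monoid A \<longleftrightarrow> mv_alg A \<and> (\<forall>e\<in>mv_monoid_eqs. mv_satisfies A e)"
proof (intro iffI conjI)
  assume "mv_monoid A"
  then interpret mv_monoid A .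
  show "mv_alg A" by unfold_locales
  show "\<forall>e\<in>mv_monoid_eqs. mv_satisfies A e" using satisfies_mv_monoid_eqs by blast
next
  assume A: "mv_alg A \<and> (\<forall>e\<in>mv_monoid_eqs. mv_satisfies A e)"
  then interpret mv_alg A by blast
  \<comment> \<open>The valuation sends variable 0 to \<open>x\<close>, variable 1 to
    \<open>y\<close> and all others to \<open>z\<close>, so each equation becomes a locale
    axiom.\<close>
  have "\<forall>e\<in>mv_monoid_eqs.
      mv_eval A (\<lambda>n. if n = 0 then x else if n = 1 then y else z) (fst e) =
      mv_eval A (\<lambda>n. if n = 0 then x else if n = 1 then y else z) (snd e)"
    if "x \<in> carrier A" "y \<in> carrier A" "z \<in> carrier A" for x y z
    using A that unfolding mv_satisfies_def by (auto simp: image_subset_iff)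
  note eqs = this[unfolded mv_monoid_eqs_def Let_def, simplified]
  have oplus: "comm_monoid \<lparr>carrier = carrier A, mult = mv_oplus A, one = mv_zero A\<rparr>"
    by (rule comm_monoidI) (simp_all add: zero_closed oplus_closed, (use eqs zero_closed in metis)+)
  have odot: "comm_monoid \<lparr>carrier = carrier A, mult = mv_odot A, one = mv_one A\<rparr>"
    by (rule comm_monoidI) (simp_all add: one_closed odot_closed, (use eqs one_closed in metis)+)
  show "mv_monoid A"
    by (intro mv_monoid.intro mv_bounded_distrib_lattice.intro mv_bounded_distrib_lattice_axioms.intro
        mv_monoid_axioms.intro oplus odot mv_alg_axioms)
      ((use eqs zero_closed one_closed in metis)+)
qed


section \<open>Order, duality and idempotents\<close>

text \<open>Keeping the carrier and exchanging the operations in pairs lets results about joins with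
  an idempotent yield those about meets.\<close>

definition mv_dual :: "'a mv_struct \<Rightarrow> 'a mv_struct" where
  "mv_dual A = \<lparr>carrier = carrier A, mv_join = mv_meet A, mv_meet = mv_join A,
     mv_oplus = mv_odot A, mv_odot = mv_oplus A, mv_zero = mv_one A, mv_one = mv_zero A\<rparr>"

lemma mv_dual_simps [simp]:
  "carrier (mv_dual A) = carrier A" "mv_join (mv_dual A) = mv_meet A"
  "mv_meet (mv_dual A) = mv_join A" "mv_oplus (mv_dual A) = mv_odot A"
  "mv_odot (mv_dual A) = mv_oplus A" "mv_zero (mv_dual A) = mv_one A"
  "mv_one (mv_dual A) = mv_zero A"
  by (simp_all add: mv_dual_def)

context mv_monoid
begin

lemma join_meet_distrib:
  assumes [simp]: "x \<in> carrier A" "y \<in> carrier A" "z \<in> carrier A"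
  shows "x \<curlyvee> (y \<curlywedge> z) = (x \<curlyvee> y) \<curlywedge> (x \<curlyvee> z)"
proof -
  have "(x \<curlyvee> y) \<curlywedge> (x \<curlyvee> z) = ((x \<curlyvee> y) \<curlywedge> x) \<curlyvee> ((x \<curlyvee> y) \<curlywedge> z)"
    by (rule meet_join_distrib) auto
  also have "\<dots> = x \<curlyvee> ((z \<curlywedge> x) \<curlyvee> (z \<curlywedge> y))"
    by (simp add: meet_comm[of "x \<curlyvee> y"] meet_absorb meet_join_distrib)
  also have "\<dots> = (x \<curlyvee> (x \<curlywedge> z)) \<curlyvee> (y \<curlywedge> z)"
    by (simp add: join_assoc meet_comm)
  finally show ?thesis by (simp add: join_absorb)
qed

text \<open>The first two MV axioms are exchanged, as are the last two; distributivity of join over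
  meet has to be supplied by \<open>join_meet_distrib\<close>.\<close>

lemma mv_monoid_dual: "mv_monoid (mv_dual A)"
  by unfold_locales
    (auto simp: join_assoc meet_assoc join_absorb meet_absorb join_meet_distrib join_zero meet_one
      oplus_join_distrib oplus_meet_distrib odot_join_distrib odot_meet_distrib
      mv_ax3[symmetric] mv_ax4[symmetric] oplus_assoc odot_assoc
      oplus_zero odot_one Units_def oplus_comm[of "mv_zero A"] odot_comm[of "mv_one A"]
      intro: join_comm meet_comm oplus_comm odot_comm mv_ax1 mv_ax2)

text \<open>Carrier membership is built into the order, so an inequality also supplies the closure
  conditions for both of its sides.\<close>

definition le (infix "\<preceq>" 50) where
  "x \<preceq> y \<longleftrightarrow> x \<in> carrier A \<and> y \<in> carrier A \<and> x \<curlywedge> y = x"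

lemma le_carrier: "x \<preceq> y \<Longrightarrow> x \<in> carrier A" "x \<preceq> y \<Longrightarrow> y \<in> carrier A"
  by (simp_all add: le_def)

lemma le_trans [trans]: "x \<preceq> y \<Longrightarrow> y \<preceq> z \<Longrightarrow> x \<preceq> z"
  unfolding le_def using meet_assoc by metis

lemma le_antisym: "x \<preceq> y \<Longrightarrow> y \<preceq> x \<Longrightarrow> x = y"
  unfolding le_def using meet_comm by metis

lemma meet_idem: "x \<in> carrier A \<Longrightarrow> x \<curlywedge> x = x"
  using meet_absorb join_zero zero_closed by metis

lemma join_idem: "x \<in> carrier A \<Longrightarrow> x \<curlyvee> x = x"
  using join_absorb meet_one one_closed by metis

lemma le_refl [simp]: "x \<in> carrier A \<Longrightarrow> x \<preceq> x"
  by (simp add: le_def meet_idem)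

lemma le_iff_join: "x \<preceq> y \<longleftrightarrow> x \<in> carrier A \<and> y \<in> carrier A \<and> x \<curlyvee> y = y"
  unfolding le_def using meet_absorb join_absorb meet_comm join_comm by metis

lemma zero_le [simp]: "x \<in> carrier A \<Longrightarrow> mv_zero A \<preceq> x"
  by (simp add: le_iff_join join_comm[of "mv_zero A"] join_zero)

lemma le_one [simp]: "x \<in> carrier A \<Longrightarrow> x \<preceq> mv_one A"
  by (simp add: le_def meet_one)

lemma meet_le1: "x \<in> carrier A \<Longrightarrow> y \<in> carrier A \<Longrightarrow> x \<curlywedge> y \<preceq> x"
  by (simp add: le_iff_join) (metis join_absorb join_comm meet_closed)

lemma meet_le2: "x \<in> carrier A \<Longrightarrow> y \<in> carrier A \<Longrightarrow> x \<curlywedge> y \<preceq> y"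
  using meet_le1 meet_comm by metis

lemma le_meetI: "z \<preceq> x \<Longrightarrow> z \<preceq> y \<Longrightarrow> z \<preceq> x \<curlywedge> y"
  by (simp add: le_def) (metis meet_assoc)

lemma le_join1: "x \<in> carrier A \<Longrightarrow> y \<in> carrier A \<Longrightarrow> x \<preceq> x \<curlyvee> y"
  by (simp add: le_def meet_absorb)

lemma le_join2: "x \<in> carrier A \<Longrightarrow> y \<in> carrier A \<Longrightarrow> y \<preceq> x \<curlyvee> y"
  using le_join1 join_comm by metis

lemma join_leI: "x \<preceq> z \<Longrightarrow> y \<preceq> z \<Longrightarrow> x \<curlyvee> y \<preceq> z"
  by (simp add: le_iff_join) (metis join_assoc)

lemma oplus_mono: "x \<preceq> x' \<Longrightarrow> y \<preceq> y' \<Longrightarrow> x \<oplus> y \<preceq> x' \<oplus> y'"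
proof -
  have *: "z \<oplus> x \<preceq> z \<oplus> y" if "x \<preceq> y" "z \<in> carrier A" for x y z
    using that by (auto simp: le_def oplus_meet_distrib[symmetric])
  assume xy: "x \<preceq> x'" "y \<preceq> y'"
  then show ?thesis
    using *[OF xy(1), of y] *[OF xy(2), of x'] le_carrier[OF xy(1)] le_carrier[OF xy(2)] le_trans
    by (simp add: oplus_comm)
qed

lemma odot_mono: "x \<preceq> x' \<Longrightarrow> y \<preceq> y' \<Longrightarrow> x \<odot> y \<preceq> x' \<odot> y'"
proof -
  have *: "z \<odot> x \<preceq> z \<odot> y" if "x \<preceq> y" "z \<in> carrier A" for x y z
    using that by (auto simp: le_def odot_meet_distrib[symmetric])
  assume xy: "x \<preceq> x'" "y \<preceq> y'"
  then show ?thesis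
    using *[OF xy(1), of y] *[OF xy(2), of x'] le_carrier[OF xy(1)] le_carrier[OF xy(2)] le_trans
    by (simp add: odot_comm)
qed

lemma le_oplus1: "x \<in> carrier A \<Longrightarrow> y \<in> carrier A \<Longrightarrow> x \<preceq> x \<oplus> y"
  using oplus_mono[of x x "mv_zero A" y] by (simp add: oplus_zero)

lemma le_oplus2: "x \<in> carrier A \<Longrightarrow> y \<in> carrier A \<Longrightarrow> y \<preceq> x \<oplus> y"
  using le_oplus1 oplus_comm by metis

lemma odot_le1: "x \<in> carrier A \<Longrightarrow> y \<in> carrier A \<Longrightarrow> x \<odot> y \<preceq> x"
  using odot_mono[of x x y "mv_one A"] by (simp add: odot_one)

lemma odot_le2: "x \<in> carrier A \<Longrightarrow> y \<in> carrier A \<Longrightarrow> x \<odot> y \<preceq> y"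
  using odot_le1 odot_comm by metis

lemma zero_simps [simp]:
  assumes "x \<in> carrier A"
  shows "mv_zero A \<oplus> x = x" "x \<oplus> mv_zero A = x" "mv_zero A \<odot> x = mv_zero A"
    "x \<odot> mv_zero A = mv_zero A"
  using assms oplus_zero oplus_comm[of "mv_zero A" x] odot_le1[of "mv_zero A" x]
    odot_le2[of x "mv_zero A"] le_antisym
  by auto

lemma one_simps [simp]:
  assumes "x \<in> carrier A"
  shows "mv_one A \<odot> x = x" "x \<odot> mv_one A = x" "mv_one A \<oplus> x = mv_one A"
    "x \<oplus> mv_one A = mv_one A"
  using assms odot_one odot_comm[of "mv_one A" x] le_oplus1[of "mv_one A" x]
    le_oplus2[of x "mv_one A"] le_antisym
  by auto

text \<open>The third axiom at \<open>x = y = e\<close> gives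
  \<open>e \<oplus> z = (e \<odot> (e \<oplus> z)) \<curlyvee> z\<close>, and the first joinand lies
  below \<open>e\<close>.\<close>

lemma idempotent_oplus:
  assumes e: "e \<in> carrier A" "e \<oplus> e = e" "e \<odot> e = e" and z: "z \<in> carrier A"
  shows "e \<oplus> z = e \<curlyvee> z"
proof (rule le_antisym)
  have "e \<oplus> z = (e \<odot> (e \<oplus> z)) \<curlyvee> z"
    using mv_ax3[OF e(1,1) z] e by simp
  then show "e \<oplus> z \<preceq> e \<curlyvee> z"
    using join_leI[OF le_trans[OF odot_le1[of e "e \<oplus> z"] le_join1[of e z]] le_join2[of e z]] e z
    by simp
  show "e \<curlyvee> z \<preceq> e \<oplus> z"
    using e z by (simp add: join_leI le_oplus1 le_oplus2)
qed

lemma join_odot_absorb: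
  assumes "x \<in> carrier A" "y \<in> carrier A"
  shows "x \<curlyvee> (x \<odot> y) = x"
  using assms odot_le1[of x y] join_comm by (simp add: le_iff_join)

end

locale mv_idempotent = mv_monoid +
  fixes e
  assumes e [simp]: "e \<in> carrier A" "e \<oplus> e = e" "e \<odot> e = e"
begin

lemma dual: "mv_idempotent (mv_dual A) e"
  by (intro mv_idempotent.intro mv_monoid_dual mv_idempotent_axioms.intro) auto

lemma oplus_e: "z \<in> carrier A \<Longrightarrow> e \<oplus> z = e \<curlyvee> z"
  by (rule idempotent_oplus) auto

text \<open>These identities make equality after joining with \<open>e\<close> compatible with the
  operations. For the sum, joining with \<open>e\<close> is adding \<open>e\<close>; for the
  product, distribute and absorb into \<open>e\<close> every term containing it.\<close>

lemma join_e_ops: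
  assumes [simp]: "x \<in> carrier A" "y \<in> carrier A"
  shows "e \<curlyvee> ((e \<curlyvee> x) \<curlyvee> (e \<curlyvee> y)) = e \<curlyvee> (x \<curlyvee> y)"
    "e \<curlyvee> ((e \<curlyvee> x) \<curlywedge> (e \<curlyvee> y)) = e \<curlyvee> (x \<curlywedge> y)"
    "e \<curlyvee> ((e \<curlyvee> x) \<oplus> (e \<curlyvee> y)) = e \<curlyvee> (x \<oplus> y)"
    "e \<curlyvee> ((e \<curlyvee> x) \<odot> (e \<curlyvee> y)) = e \<curlyvee> (x \<odot> y)"
proof -
  have *: "e \<curlyvee> (e \<curlyvee> z) = e \<curlyvee> z" if "z \<in> carrier A" for z
    using that join_assoc[of e e z] by (simp add: join_idem)
  have l: "x \<curlyvee> (y \<curlyvee> z) = y \<curlyvee> (x \<curlyvee> z)" if "x \<in> carrier A" "y \<in> carrier A" "z \<in> carrier A" for x y z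
    using that join_assoc[of x y z] join_assoc[of y x z] join_comm[of x y] by simp
  show "e \<curlyvee> ((e \<curlyvee> x) \<curlyvee> (e \<curlyvee> y)) = e \<curlyvee> (x \<curlyvee> y)"
    by (simp add: join_assoc l[of x e y] *)
  show "e \<curlyvee> ((e \<curlyvee> x) \<curlywedge> (e \<curlyvee> y)) = e \<curlyvee> (x \<curlywedge> y)"
    by (simp add: join_meet_distrib *)
  have e2: "e \<oplus> (e \<oplus> z) = e \<oplus> z" if "z \<in> carrier A" for z
    using that oplus_assoc[of e e z] by simp
  have "e \<oplus> ((e \<oplus> x) \<oplus> (e \<oplus> y)) = e \<oplus> (x \<oplus> y)"
    using oplus_assoc[of x e y, symmetric] oplus_comm[of x e] by (simp add: oplus_assoc e2)
  then show "e \<curlyvee> ((e \<curlyvee> x) \<oplus> (e \<curlyvee> y)) = e \<curlyvee> (x \<oplus> y)"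
    by (simp add: oplus_e)
  have "(e \<curlyvee> x) \<odot> (e \<curlyvee> y) = (e \<odot> (e \<curlyvee> y)) \<curlyvee> (x \<odot> (e \<curlyvee> y))"
    using odot_comm[of "e \<curlyvee> y"] odot_join_distrib[of "e \<curlyvee> y" e x] by simp
  also have "\<dots> = (e \<curlyvee> (e \<odot> y)) \<curlyvee> ((x \<odot> e) \<curlyvee> (x \<odot> y))"
    by (simp add: odot_join_distrib)
  also have "\<dots> = e \<curlyvee> ((e \<odot> x) \<curlyvee> (x \<odot> y))"
    by (simp add: join_odot_absorb odot_comm)
  also have "\<dots> = e \<curlyvee> (x \<odot> y)"
    by (simp add: join_odot_absorb join_assoc[symmetric])
  finally show "e \<curlyvee> ((e \<curlyvee> x) \<odot> (e \<curlyvee> y)) = e \<curlyvee> (x \<odot> y)"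
    by (simp add: *)
qed

text \<open>Distributivity rebuilds \<open>x\<close> from its join and meet with \<open>e\<close>.
  Hence the two congruences induced by an idempotent intersect trivially.\<close>

lemma join_meet_cancel:
  assumes [simp]: "x \<in> carrier A" "y \<in> carrier A" and eq: "e \<curlyvee> x = e \<curlyvee> y" "e \<curlywedge> x = e \<curlywedge> y"
  shows "x = y"
proof -
  have "x = x \<curlywedge> (e \<curlyvee> x)"
    using meet_absorb[of x e] by (simp add: join_comm)
  also have "\<dots> = (e \<curlywedge> y) \<curlyvee> (x \<curlywedge> y)"
    by (simp only: eq) (simp add: meet_join_distrib eq(2) meet_comm[of x e])
  also have "\<dots> = y \<curlywedge> (e \<curlyvee> x)"
    by (simp add: meet_join_distrib meet_comm)
  also have "\<dots> = y"
    using meet_absorb[of y e] by (simp add: eq join_comm)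
  finally show ?thesis .
qed

end

section \<open>Congruences and quotients\<close>

definition mv_cong :: "'a mv_struct \<Rightarrow> 'a rel \<Rightarrow> bool" where
  "mv_cong A \<theta> \<longleftrightarrow> equiv (carrier A) \<theta> \<and>
    (\<forall>x x' y y'. (x, x') \<in> \<theta> \<longrightarrow> (y, y') \<in> \<theta> \<longrightarrow>
      (mv_join A x y, mv_join A x' y') \<in> \<theta> \<and> (mv_meet A x y, mv_meet A x' y') \<in> \<theta> \<and>
      (mv_oplus A x y, mv_oplus A x' y') \<in> \<theta> \<and> (mv_odot A x y, mv_odot A x' y') \<in> \<theta>)"

lemma mv_cong_dual: "mv_cong (mv_dual A) \<theta> \<longleftrightarrow> mv_cong A \<theta>"
  by (auto simp: mv_cong_def)

text \<open>Congruences of a quotient are brought back to \<open>A\<close>, where the maximality of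
  the separating congruence is stated.\<close>

lemma mv_cong_pullback:
  assumes "mv_alg A" and g: "g \<in> mv_hom A B" and "mv_cong B \<theta>"
  shows "mv_cong A {(x, y). x \<in> carrier A \<and> y \<in> carrier A \<and> (g x, g y) \<in> \<theta>}"
proof -
  interpret mv_alg A by fact
  have "equiv (carrier B) \<theta>" using assms(3) by (simp add: mv_cong_def)
  then have "refl_on (carrier B) \<theta>" "sym \<theta>" "trans \<theta>" by (auto simp: equiv_def)
  moreover have "g x \<in> carrier B" if "x \<in> carrier A" for x using g that by (auto simp: mv_hom_def)
  ultimately have "equiv (carrier A) {(x, y). x \<in> carrier A \<and> y \<in> carrier A \<and> (g x, g y) \<in> \<theta>}"
    by (auto simp: equiv_def refl_on_def sym_def intro!: transI dest: transD)
  then show ?thesis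
    using g assms(3) unfolding mv_cong_def mv_hom_def
    by (auto simp: join_closed meet_closed oplus_closed odot_closed)
qed

context mv_idempotent
begin

lemma mv_cong_join: "mv_cong A {(x, y). x \<in> carrier A \<and> y \<in> carrier A \<and> e \<curlyvee> x = e \<curlyvee> y}"
  unfolding mv_cong_def
proof (intro conjI allI impI)
  show "equiv (carrier A) {(x, y). x \<in> carrier A \<and> y \<in> carrier A \<and> e \<curlyvee> x = e \<curlyvee> y}"
    by (auto simp: equiv_def refl_on_def sym_def intro!: transI)
qed (clarsimp, metis join_e_ops)+

lemma mv_cong_meet: "mv_cong A {(x, y). x \<in> carrier A \<and> y \<in> carrier A \<and> e \<curlywedge> x = e \<curlywedge> y}"
  using mv_idempotent.mv_cong_join[OF dual] by (simp add: mv_cong_dual)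

end

definition mv_rep :: "'a rel \<Rightarrow> 'a \<Rightarrow> 'a" where
  "mv_rep \<theta> x = (SOME y. (x, y) \<in> \<theta>)"

text \<open>Elements of the quotient are chosen representatives of the classes, so that the quotient lives
  in the same type.\<close>

definition mv_quotient :: "'a mv_struct \<Rightarrow> 'a rel \<Rightarrow> 'a mv_struct" where
  "mv_quotient A \<theta> = \<lparr>carrier = mv_rep \<theta> ` carrier A,
     mv_join = (\<lambda>x y. mv_rep \<theta> (mv_join A x y)), mv_meet = (\<lambda>x y. mv_rep \<theta> (mv_meet A x y)),
     mv_oplus = (\<lambda>x y. mv_rep \<theta> (mv_oplus A x y)), mv_odot = (\<lambda>x y. mv_rep \<theta> (mv_odot A x y)),
     mv_zero = mv_rep \<theta> (mv_zero A), mv_one = mv_rep \<theta> (mv_one A)\<rparr>"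

context
  fixes A :: "'a mv_struct" and \<theta>
  assumes cong: "mv_cong A \<theta>"
begin

lemma mv_rep_related: "x \<in> carrier A \<Longrightarrow> (x, mv_rep \<theta> x) \<in> \<theta>"
  unfolding mv_rep_def
  by (rule someI[of _ x]) (use cong in \<open>auto simp: mv_cong_def equiv_def refl_on_def\<close>)

lemma mv_rep_eq_iff:
  assumes "x \<in> carrier A" "y \<in> carrier A"
  shows "mv_rep \<theta> x = mv_rep \<theta> y \<longleftrightarrow> (x, y) \<in> \<theta>"
proof
  have st: "sym \<theta>" "trans \<theta>" using cong by (auto simp: mv_cong_def equiv_def)
  note rel = mv_rep_related[OF assms(1)] mv_rep_related[OF assms(2)]
  show "(x, y) \<in> \<theta>" if "mv_rep \<theta> x = mv_rep \<theta> y"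
    using rel that transD[OF st(2)] symD[OF st(1)] by metis
  show "mv_rep \<theta> x = mv_rep \<theta> y" if "(x, y) \<in> \<theta>"
  proof -
    \<comment> \<open>Related elements have the same class, so the choice operator sees the same
      predicate and returns the same representative.\<close>
    have "(x, z) \<in> \<theta> \<longleftrightarrow> (y, z) \<in> \<theta>" for z
      using that st by (blast dest: symD transD)
    then show ?thesis by (simp add: mv_rep_def)
  qed
qed

context
  assumes A: "mv_alg A"
begin

interpretation mv_alg A by (rule A)

lemma mv_rep_ops:
  assumes "x \<in> carrier A" "y \<in> carrier A"
  shows "mv_rep \<theta> (mv_join A (mv_rep \<theta> x) (mv_rep \<theta> y)) = mv_rep \<theta> (mv_join A x y)"
    "mv_rep \<theta> (mv_meet A (mv_rep \<theta> x) (mv_rep \<theta> y)) = mv_rep \<theta> (mv_meet A x y)"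
    "mv_rep \<theta> (mv_oplus A (mv_rep \<theta> x) (mv_rep \<theta> y)) = mv_rep \<theta> (mv_oplus A x y)"
    "mv_rep \<theta> (mv_odot A (mv_rep \<theta> x) (mv_rep \<theta> y)) = mv_rep \<theta> (mv_odot A x y)"
proof -
  have sub: "equiv (carrier A) \<theta>" using cong by (auto simp: mv_cong_def)
  have "(x, mv_rep \<theta> x) \<in> \<theta>" "(y, mv_rep \<theta> y) \<in> \<theta>" using assms by (auto intro: mv_rep_related)
  then have "(mv_rep \<theta> x, x) \<in> \<theta>" "(mv_rep \<theta> y, y) \<in> \<theta>"
    using sub by (auto simp: equiv_def sym_def)
  then have *: "(mv_join A (mv_rep \<theta> x) (mv_rep \<theta> y), mv_join A x y) \<in> \<theta>"
    "(mv_meet A (mv_rep \<theta> x) (mv_rep \<theta> y), mv_meet A x y) \<in> \<theta>"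
    "(mv_oplus A (mv_rep \<theta> x) (mv_rep \<theta> y), mv_oplus A x y) \<in> \<theta>"
    "(mv_odot A (mv_rep \<theta> x) (mv_rep \<theta> y), mv_odot A x y) \<in> \<theta>"
    using cong by (auto simp: mv_cong_def)
  have eq: "mv_rep \<theta> s = mv_rep \<theta> t" if "(s, t) \<in> \<theta>" for s t
    using that sub mv_rep_eq_iff[of s t] unfolding equiv_def by blast
  show "mv_rep \<theta> (mv_join A (mv_rep \<theta> x) (mv_rep \<theta> y)) = mv_rep \<theta> (mv_join A x y)"
    "mv_rep \<theta> (mv_meet A (mv_rep \<theta> x) (mv_rep \<theta> y)) = mv_rep \<theta> (mv_meet A x y)"
    "mv_rep \<theta> (mv_oplus A (mv_rep \<theta> x) (mv_rep \<theta> y)) = mv_rep \<theta> (mv_oplus A x y)"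
    "mv_rep \<theta> (mv_odot A (mv_rep \<theta> x) (mv_rep \<theta> y)) = mv_rep \<theta> (mv_odot A x y)"
    by (rule eq, rule *)+
qed

lemma mv_rep_hom: "mv_rep \<theta> \<in> mv_hom A (mv_quotient A \<theta>)"
  by (auto simp: mv_hom_def mv_quotient_def mv_rep_ops)

lemma mv_alg_quotient: "mv_alg (mv_quotient A \<theta>)"
  by unfold_locales
    (auto simp: mv_quotient_def mv_rep_ops intro: zero_closed one_closed join_closed meet_closed
      oplus_closed odot_closed)

end

end

lemma carrier_mv_quotient: "carrier (mv_quotient A \<theta>) = mv_rep \<theta> ` carrier A"
  by (simp add: mv_quotient_def)

lemma quotient_satisfies:
  assumes "mv_alg A" "mv_cong A \<theta>" "mv_satisfies A e"
  shows "mv_satisfies (mv_quotient A \<theta>) e"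
  using mv_satisfies_surj_hom[OF assms(1) mv_rep_hom[OF assms(2,1)] _ assms(3)]
  by (simp add: carrier_mv_quotient)

lemma mv_monoid_quotient:
  assumes "mv_monoid A" "mv_cong A \<theta>"
  shows "mv_monoid (mv_quotient A \<theta>)"
proof -
  have A: "mv_alg A" "\<And>e. e \<in> mv_monoid_eqs \<Longrightarrow> mv_satisfies A e"
    using assms(1) by (simp_all add: mv_monoid_iff_eqs)
  show ?thesis
    using mv_alg_quotient[OF assms(2) A(1)] quotient_satisfies[OF A(1) assms(2) A(2)]
    by (simp add: mv_monoid_iff_eqs)
qed

text \<open>Zorn's lemma applies to the congruences that do not relate \<open>a\<close> and
  \<open>b\<close>; the identity relation is one of them.\<close>

lemma ex_maximal_separating_cong:
  assumes "mv_alg A" and ab: "a \<noteq> b"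
  obtains \<theta> where "mv_cong A \<theta>" "(a, b) \<notin> \<theta>"
    "\<And>\<eta>. mv_cong A \<eta> \<Longrightarrow> \<theta> \<subseteq> \<eta> \<Longrightarrow> (a, b) \<notin> \<eta> \<Longrightarrow> \<eta> = \<theta>"
proof -
  interpret mv_alg A by fact
  define \<C> where "\<C> = {\<theta>. mv_cong A \<theta> \<and> (a, b) \<notin> \<theta>}"
  have "mv_cong A (Id_on (carrier A))"
    by (auto simp: mv_cong_def equiv_def refl_on_def sym_def trans_def
        join_closed meet_closed oplus_closed odot_closed)
  then have "Id_on (carrier A) \<in> \<C>"
    using ab by (auto simp: \<C>_def)
  then have ne: "\<C> \<noteq> {}" by blast
  have "\<Union>C \<in> \<C>" if C: "C \<noteq> {}" "subset.chain \<C> C" for C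
  proof -
    have sub: "mv_cong A \<theta>" "(a, b) \<notin> \<theta>" if "\<theta> \<in> C" for \<theta>
      using C(2) that by (auto simp: \<C>_def subset.chain_def)
    \<comment> \<open>The closure conditions involve at most two pairs at a time, and two pairs from
      the union of a chain lie in a common member.\<close>
    have joint: "\<exists>\<theta>\<in>C. p \<in> \<theta> \<and> q \<in> \<theta>" if pq: "p \<in> \<Union>C" "q \<in> \<Union>C" for p q
    proof -
      obtain S T where ST: "S \<in> C" "p \<in> S" "T \<in> C" "q \<in> T" using pq by blast
      then have "S \<subseteq> T \<or> T \<subseteq> S" using C(2) by (auto simp: subset_chain_def)
      then show ?thesis using ST by blast
    qed
    have eq: "equiv (carrier A) \<theta>" if "\<theta> \<in> C" for \<theta>
      using sub[OF that] by (auto simp: mv_cong_def)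
    have "equiv (carrier A) (\<Union>C)"
    proof (rule equivI)
      show "\<Union>C \<subseteq> carrier A \<times> carrier A"
        using eq by (auto simp: equiv_def)
      show "refl_on (carrier A) (\<Union>C)"
        using eq C(1) by (auto simp: equiv_def refl_on_def)
      show "sym (\<Union>C)"
        using eq by (auto simp: equiv_def sym_def)
      show "trans (\<Union>C)"
      proof (rule transI)
        fix x y z assume "(x, y) \<in> \<Union>C" "(y, z) \<in> \<Union>C"
        then obtain \<theta> where "\<theta> \<in> C" "(x, y) \<in> \<theta>" "(y, z) \<in> \<theta>" using joint by blast
        then show "(x, z) \<in> \<Union>C" using eq[of \<theta>] by (auto simp: equiv_def dest: transD)
      qed
    qed
    moreover have "(mv_join A x y, mv_join A x' y') \<in> \<Union>C \<and> (mv_meet A x y, mv_meet A x' y') \<in> \<Union>C \<and>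
      (mv_oplus A x y, mv_oplus A x' y') \<in> \<Union>C \<and> (mv_odot A x y, mv_odot A x' y') \<in> \<Union>C"
      if xy: "(x, x') \<in> \<Union>C" "(y, y') \<in> \<Union>C" for x x' y y'
    proof -
      from xy obtain \<theta> where "\<theta> \<in> C" "(x, x') \<in> \<theta>" "(y, y') \<in> \<theta>" using joint by blast
      then show ?thesis using sub(1)[of \<theta>] unfolding mv_cong_def by blast
    qed
    ultimately have "mv_cong A (\<Union>C)" by (auto simp: mv_cong_def)
    then show ?thesis using sub(2) by (auto simp: \<C>_def)
  qed
  from subset_Zorn_nonempty[OF ne this] obtain \<theta> where \<theta>: "\<theta> \<in> \<C>"
    "\<And>\<eta>. \<eta> \<in> \<C> \<Longrightarrow> \<theta> \<subseteq> \<eta> \<Longrightarrow> \<eta> = \<theta>" by metis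
  show thesis by (rule that[of \<theta>]) (use \<theta> in \<open>auto simp: \<C>_def\<close>)
qed

text \<open>Both congruences induced by \<open>e\<close> pull back to congruences above
  \<open>\<theta>\<close>. One still separates \<open>a\<close> from \<open>b\<close>, so it equals
  \<open>\<theta>\<close>. The one from joins relates a preimage of \<open>e\<close> to 0, the one
  from meets relates it to 1.\<close>

lemma idempotent_in_maximal_quotient:
  assumes A: "mv_monoid A" and \<theta>: "mv_cong A \<theta>" "(a, b) \<notin> \<theta>"
    and max: "\<And>\<eta>. mv_cong A \<eta> \<Longrightarrow> \<theta> \<subseteq> \<eta> \<Longrightarrow> (a, b) \<notin> \<eta> \<Longrightarrow> \<eta> = \<theta>"
    and ab: "a \<in> carrier A" "b \<in> carrier A"
    and Q: "Q = mv_quotient A \<theta>"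
    and e: "e \<in> carrier Q" "mv_oplus Q e e = e" "mv_odot Q e e = e"
  shows "e = mv_zero Q \<or> e = mv_one Q"
proof -
  let ?g = "mv_rep \<theta>"
  interpret A: mv_monoid A by fact
  interpret Q: mv_monoid Q unfolding Q using A \<theta>(1) by (rule mv_monoid_quotient)
  interpret E: mv_idempotent Q e by unfold_locales (fact e)+
  have alg: "mv_alg A" by unfold_locales
  have g: "?g \<in> mv_hom A Q" unfolding Q by (rule mv_rep_hom[OF \<theta>(1) alg])
  have eq: "?g x = ?g y \<longleftrightarrow> (x, y) \<in> \<theta>" if "x \<in> carrier A" "y \<in> carrier A" for x y
    using \<theta>(1) that by (rule mv_rep_eq_iff)
  have gc: "?g x \<in> carrier Q" if "x \<in> carrier A" for x using g that by (auto simp: mv_hom_def)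
  have \<theta>sub: "x \<in> carrier A" "y \<in> carrier A" if "(x, y) \<in> \<theta>" for x y
    using that \<theta>(1) by (auto simp: mv_cong_def equiv_def)
  obtain c where c: "c \<in> carrier A" "e = ?g c" using e(1) by (auto simp: Q carrier_mv_quotient)
  define \<theta>1 where "\<theta>1 = {(x, y). x \<in> carrier A \<and> y \<in> carrier A \<and> (?g x, ?g y) \<in>
    {(x, y). x \<in> carrier Q \<and> y \<in> carrier Q \<and> mv_join Q e x = mv_join Q e y}}"
  define \<theta>2 where "\<theta>2 = {(x, y). x \<in> carrier A \<and> y \<in> carrier A \<and> (?g x, ?g y) \<in>
    {(x, y). x \<in> carrier Q \<and> y \<in> carrier Q \<and> mv_meet Q e x = mv_meet Q e y}}"
  have cong: "mv_cong A \<theta>1" "mv_cong A \<theta>2"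
    unfolding \<theta>1_def \<theta>2_def
    by (rule mv_cong_pullback[OF alg g] E.mv_cong_join E.mv_cong_meet)+
  have sub: "\<theta> \<subseteq> \<theta>1" "\<theta> \<subseteq> \<theta>2"
    using \<theta>sub eq[THEN iffD2] gc by (auto simp: \<theta>1_def \<theta>2_def)
  have "?g a \<noteq> ?g b" using eq ab \<theta>(2) by blast
  then have "(a, b) \<notin> \<theta>1 \<or> (a, b) \<notin> \<theta>2"
    using E.join_meet_cancel[OF gc[OF ab(1)] gc[OF ab(2)]] by (auto simp: \<theta>1_def \<theta>2_def)
  then consider "\<theta>1 = \<theta>" | "\<theta>2 = \<theta>" using max cong sub by blast
  then show ?thesis
  proof cases
    case 1
    have "?g (mv_zero A) = mv_zero Q" using g by (simp add: mv_hom_def)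
    then have "(c, mv_zero A) \<in> \<theta>1"
      using c e(1) by (auto simp: \<theta>1_def Q.join_zero Q.join_idem)
    then have "e = mv_zero Q"
      using 1 c eq[OF c(1) A.zero_closed] \<open>?g (mv_zero A) = mv_zero Q\<close> by simp
    then show ?thesis ..
  next
    case 2
    have "?g (mv_one A) = mv_one Q" using g by (simp add: mv_hom_def)
    then have "(c, mv_one A) \<in> \<theta>2"
      using c e(1) by (auto simp: \<theta>2_def Q.meet_one Q.meet_idem)
    then have "e = mv_one Q"
      using 2 c eq[OF c(1) A.one_closed] \<open>?g (mv_one A) = mv_one Q\<close> by simp
    then show ?thesis ..
  qed
qed

section \<open>Simple complemented MV-monoids\<close>

context mv_monoid
begin

text \<open>Multiples of elements rather than of terms. The recursion adds to zero from the start,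
  and \<open>eval_mv_times\<close> links it to \<open>mv_times\<close>.\<close>

primrec mul :: "nat \<Rightarrow> 'a \<Rightarrow> 'a" where
  "mul 0 x = mv_zero A"
| "mul (Suc k) x = mul k x \<oplus> x"

lemma mul_closed [simp]: "x \<in> carrier A \<Longrightarrow> mul k x \<in> carrier A"
  by (induction k) auto

lemma mul_add: "x \<in> carrier A \<Longrightarrow> mul (j + k) x = mul j x \<oplus> mul k x"
  by (induction k) (auto simp: oplus_assoc)

lemma mul_mono: "x \<in> carrier A \<Longrightarrow> j \<le> k \<Longrightarrow> mul j x \<preceq> mul k x"
  using mul_add[of x j "k - j"] le_oplus1[of "mul j x" "mul (k - j) x"] by simp

lemma mul_double: "x \<in> carrier A \<Longrightarrow> mul k (x \<oplus> x) = mul (2 * k) x"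
  by (induction k) (auto simp: oplus_assoc)

lemma mul_mono_arg: "x \<preceq> y \<Longrightarrow> mul k x \<preceq> mul k y"
  using le_carrier by (induction k) (auto intro: oplus_mono)

lemma mul_stable:
  assumes "x \<in> carrier A" "mul (Suc m) x = mul m x"
  shows "mul (m + j) x = mul m x"
proof (induction j)
  case (Suc j)
  then show ?case using assms by simp
qed simp

lemma eval_mv_times:
  "mv_eval A v t \<in> carrier A \<Longrightarrow> mv_eval A v (mv_times k t) = mul k (mv_eval A v t)"
  by (induction k) auto

text \<open>For complementary \<open>x\<close> and \<open>y\<close> the left sides of the first two
  axioms collapse to \<open>z\<close>. The cancellation arguments below rest on this.\<close>

lemma split_by_complement:
  assumes "x \<in> carrier A" "y \<in> carrier A" "z \<in> carrier A" "x \<oplus> y = mv_one A" "x \<odot> y = mv_zero A"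
  shows "(x \<odot> (y \<oplus> z)) \<oplus> (y \<odot> z) = z" "(x \<oplus> (y \<odot> z)) \<odot> (y \<oplus> z) = z"
  using mv_ax1[OF assms(1-3)] mv_ax2[OF assms(1-3)] assms by simp_all

text \<open>One direction is monotonicity. Conversely, splitting \<open>x\<close> along
  \<open>y\<close> and \<open>y'\<close> leaves a single summand, which lies below
  \<open>y\<close>.\<close>

lemma le_iff_odot_complement:
  assumes "x \<in> carrier A" "y \<in> carrier A" "y' \<in> carrier A" "y \<oplus> y' = mv_one A" "y \<odot> y' = mv_zero A"
  shows "x \<preceq> y \<longleftrightarrow> x \<odot> y' = mv_zero A"
proof
  assume "x \<preceq> y"
  then have "x \<odot> y' \<preceq> y \<odot> y'" using assms by (intro odot_mono) auto
  then show "x \<odot> y' = mv_zero A" using assms le_antisym[OF _ zero_le] by simp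
next
  assume *: "x \<odot> y' = mv_zero A"
  have "x = y \<odot> (y' \<oplus> x)"
    using split_by_complement(1)[OF assms(2,3,1,4,5)] * assms by (simp add: odot_comm)
  then show "x \<preceq> y" using odot_le1[of y "y' \<oplus> x"] assms by simp
qed

text \<open>Splitting gives \<open>e = (e' \<odot> (e \<oplus> e)) \<oplus> (e \<odot> e)\<close>,
  and the first summand vanishes because \<open>e \<oplus> e = e\<close>.\<close>

lemma odot_idempotent_if_oplus_idempotent:
  assumes e: "e \<in> carrier A" "e \<oplus> e = e" and e': "e' \<in> carrier A" "e \<oplus> e' = mv_one A" "e \<odot> e' = mv_zero A"
  shows "e \<odot> e = e"
  using split_by_complement(1)[of e' e e] assms by (simp add: oplus_comm odot_comm)

text \<open>Expanding the right side over both meets gives a meet of sums, each of which dominates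
  the left side.\<close>

lemma meet_oplus_le:
  assumes [simp]: "a \<in> carrier A" "b \<in> carrier A" "c \<in> carrier A"
  shows "a \<curlywedge> (b \<oplus> c) \<preceq> (a \<curlywedge> b) \<oplus> (a \<curlywedge> c)"
proof -
  let ?l = "a \<curlywedge> (b \<oplus> c)"
  have a: "?l \<preceq> a" and bc: "?l \<preceq> b \<oplus> c" by (auto intro: meet_le1 meet_le2)
  have "(a \<curlywedge> b) \<oplus> (a \<curlywedge> c) = (((a \<curlywedge> b) \<oplus> a) \<curlywedge> ((a \<curlywedge> b) \<oplus> c))"
    by (simp add: oplus_meet_distrib)
  moreover have "?l \<preceq> (a \<curlywedge> b) \<oplus> a"
    using le_trans[OF a le_oplus2[of "a \<curlywedge> b" a]] by simp
  moreover have "?l \<preceq> (a \<curlywedge> b) \<oplus> c"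
  proof -
    have "?l \<preceq> (c \<oplus> a) \<curlywedge> (c \<oplus> b)"
      using le_trans[OF a le_oplus2[of c a]] bc by (intro le_meetI) (auto simp: oplus_comm)
    then show ?thesis
      using oplus_meet_distrib[of c a b] oplus_comm[of c "a \<curlywedge> b"] by simp
  qed
  ultimately show ?thesis by (simp add: le_meetI)
qed

lemma meet_mul_eq_zero:
  assumes [simp]: "a \<in> carrier A" "b \<in> carrier A" and "a \<curlywedge> b = mv_zero A"
  shows "a \<curlywedge> mul k b = mv_zero A"
proof (induction k)
  case 0
  show ?case using meet_le2[of a "mv_zero A"] by (simp add: le_antisym)
next
  case (Suc k)
  have "a \<curlywedge> mul (Suc k) b \<preceq> (a \<curlywedge> mul k b) \<oplus> (a \<curlywedge> b)"
    using meet_oplus_le[of a "mul k b" b] by simp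
  then show ?case using Suc assms(3) by (simp add: le_antisym)
qed

end

text \<open>Collects the properties of the quotient by a maximal congruence. \<open>N\<close> is any
  choice of complements, and \<open>m\<close> is the index after which multiples stop
  growing.\<close>

locale mv_simple = mv_monoid +
  fixes N :: "'a \<Rightarrow> 'a" and m :: nat
  assumes neg_closed [simp]: "x \<in> carrier A \<Longrightarrow> N x \<in> carrier A"
    and oplus_neg [simp]: "x \<in> carrier A \<Longrightarrow> x \<oplus> N x = mv_one A"
    and odot_neg [simp]: "x \<in> carrier A \<Longrightarrow> x \<odot> N x = mv_zero A"
    and nontrivial: "mv_zero A \<noteq> mv_one A"
    and idempotent_trivial: "\<lbrakk>x \<in> carrier A; x \<oplus> x = x; x \<odot> x = x\<rbrakk> \<Longrightarrow> x = mv_zero A \<or> x = mv_one A"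
    and mul_Suc_m: "x \<in> carrier A \<Longrightarrow> mul (Suc m) x = mul m x"
begin

lemma le_iff: "x \<in> carrier A \<Longrightarrow> y \<in> carrier A \<Longrightarrow> x \<preceq> y \<longleftrightarrow> x \<odot> N y = mv_zero A"
  by (rule le_iff_odot_complement) auto

text \<open>Here \<open>x \<odot> N y\<close> acts as the difference \<open>x - y\<close>: the
  splitting of \<open>x\<close> along \<open>y\<close> and \<open>N y\<close> simplifies since
  \<open>N y \<oplus> x = 1\<close>.\<close>

lemma oplus_diff:
  assumes "y \<preceq> x"
  shows "y \<oplus> (x \<odot> N y) = x"
proof -
  have [simp]: "x \<in> carrier A" "y \<in> carrier A" using le_carrier assms by auto
  have "N y \<oplus> y \<preceq> N y \<oplus> x" using assms by (intro oplus_mono) auto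
  then have "N y \<oplus> x = mv_one A" using le_antisym[OF le_one] by (simp add: oplus_comm)
  then show ?thesis using split_by_complement(1)[of y "N y" x] by (simp add: odot_comm)
qed

text \<open>Stability of multiples makes \<open>mul m x\<close> sum-idempotent; its complement makes
  it product-idempotent as well. It is therefore 0 or 1, and it lies above the nonzero
  \<open>x\<close>.\<close>

lemma mul_m_eq_one:
  assumes x: "x \<in> carrier A" "x \<noteq> mv_zero A"
  shows "mul m x = mv_one A"
proof -
  have "mul m x \<oplus> mul m x = mul m x"
    using mul_stable[OF x(1) mul_Suc_m[OF x(1)], of m] mul_add[OF x(1), of m m] by simp
  moreover from this have "mul m x \<odot> mul m x = mul m x"
    by (rule odot_idempotent_if_oplus_idempotent[where e' = "N (mul m x)", rotated]) (use x in auto)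
  ultimately have "mul m x = mv_zero A \<or> mul m x = mv_one A"
    using x by (intro idempotent_trivial) auto
  moreover have "mul m x \<noteq> mv_zero A"
  proof
    assume *: "mul m x = mv_zero A"
    have "x \<preceq> mul (Suc m) x" using x le_oplus2[of "mul m x" x] by simp
    then show False using mul_Suc_m[OF x(1)] * x by (simp add: le_antisym)
  qed
  ultimately show ?thesis by simp
qed

text \<open>A nonzero \<open>b\<close> has the multiple 1, and disjointness of \<open>a\<close> from
  \<open>b\<close> extends to all multiples of \<open>b\<close>.\<close>

lemma meet_eq_zero:
  assumes "a \<in> carrier A" "b \<in> carrier A" "a \<curlywedge> b = mv_zero A"
  shows "a = mv_zero A \<or> b = mv_zero A"
  using meet_mul_eq_zero[OF assms, of m] mul_m_eq_one[OF assms(2)] assms meet_one by auto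

text \<open>Since \<open>x = (x \<curlywedge> y) \<oplus> (x \<odot> N y)\<close> and \<open>y = (x \<curlywedge> y) \<oplus> (y \<odot> N x)\<close>, adding
  \<open>d = (x \<odot> N y) \<curlywedge> (y \<odot> N x)\<close> to \<open>x \<curlywedge> y\<close> has no effect, which forces \<open>d = 0\<close>.\<close>

lemma linear:
  assumes [simp]: "x \<in> carrier A" "y \<in> carrier A"
  shows "x \<preceq> y \<or> y \<preceq> x"
proof -
  have p: "x = (x \<curlywedge> y) \<oplus> (x \<odot> N y)" if [simp]: "x \<in> carrier A" "y \<in> carrier A" for x y
  proof -
    have x: "x = (y \<odot> (N y \<oplus> x)) \<oplus> (N y \<odot> x)"
      using split_by_complement(1)[of y "N y" x] by simp
    have "y \<odot> (N y \<oplus> x) \<preceq> x"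
      using le_oplus1[of "y \<odot> (N y \<oplus> x)" "N y \<odot> x"] x by simp
    then have "y \<odot> (N y \<oplus> x) \<preceq> x \<curlywedge> y"
      by (intro le_meetI odot_le1) auto
    then have "x \<preceq> (x \<curlywedge> y) \<oplus> (N y \<odot> x)"
      using oplus_mono[of "y \<odot> (N y \<oplus> x)" "x \<curlywedge> y" "N y \<odot> x" "N y \<odot> x"] x by simp
    moreover have "(x \<curlywedge> y) \<oplus> (N y \<odot> x) \<preceq> x"
    proof -
      \<comment> \<open>As \<open>x \<curlywedge> y\<close> lies below \<open>y\<close>, its product
        with \<open>N y\<close> vanishes, and its splitting along \<open>y\<close> and
        \<open>N y\<close> has one summand left.\<close>
      have w: "x \<curlywedge> y = y \<odot> (N y \<oplus> (x \<curlywedge> y))"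
      proof -
        have "(x \<curlywedge> y) \<odot> N y = mv_zero A"
          using le_iff[of "x \<curlywedge> y" y] meet_le2[of x y] by simp
        then show ?thesis
          using split_by_complement(1)[of y "N y" "x \<curlywedge> y"] by (simp add: odot_comm)
      qed
      have "y \<odot> (N y \<oplus> (x \<curlywedge> y)) \<preceq> y \<odot> (N y \<oplus> x)"
        by (intro odot_mono oplus_mono meet_le1) auto
      then have "(x \<curlywedge> y) \<oplus> (N y \<odot> x) \<preceq> (y \<odot> (N y \<oplus> x)) \<oplus> (N y \<odot> x)"
        using w by (intro oplus_mono) auto
      then show ?thesis using x by simp
    qed
    ultimately show ?thesis by (simp add: le_antisym odot_comm)
  qed
  define c where "c = x \<curlywedge> y"
  define d where "d = (x \<odot> N y) \<curlywedge> (y \<odot> N x)"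
  have [simp]: "c \<in> carrier A" "d \<in> carrier A" by (auto simp: c_def d_def)
  have "c \<oplus> d = x \<curlywedge> y"
    using p[of x y] p[of y x] by (simp add: c_def d_def oplus_meet_distrib meet_comm)
  then have cd: "c \<oplus> d = c" by (simp add: c_def)
  have "c \<odot> d \<preceq> y \<odot> N y"
  proof (rule odot_mono)
    show "c \<preceq> y" by (simp add: c_def meet_le2)
    show "d \<preceq> N y"
      using le_trans[OF meet_le1[of "x \<odot> N y" "y \<odot> N x"] odot_le2[of x "N y"]] by (simp add: d_def)
  qed
  then have "c \<odot> d = mv_zero A" by (simp add: le_antisym)
  \<comment> \<open>Splitting gives
    \<open>d = (N c \<odot> (c \<oplus> d)) \<oplus> (c \<odot> d)\<close>; the first summand
    vanishes because \<open>c \<oplus> d = c\<close>.\<close>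
  then have "d = mv_zero A"
    using split_by_complement(1)[of "N c" c d] cd by (simp add: oplus_comm odot_comm)
  then have "x \<odot> N y = mv_zero A \<or> y \<odot> N x = mv_zero A"
    unfolding d_def by (intro meet_eq_zero) auto
  then show ?thesis by (simp add: le_iff)
qed

definition ord :: "'a \<Rightarrow> nat" where
  "ord x = (LEAST k. mul k x = mv_one A)"

lemma mul_ord: "x \<in> carrier A \<Longrightarrow> x \<noteq> mv_zero A \<Longrightarrow> mul (ord x) x = mv_one A"
  unfolding ord_def by (rule LeastI, rule mul_m_eq_one)

lemma ord_le: "mul k x = mv_one A \<Longrightarrow> ord x \<le> k"
  unfolding ord_def by (rule Least_le)

text \<open>An element \<open>u\<close> of greatest order is an atom. If it were not below some
  nonzero \<open>v\<close>, the smaller of \<open>v\<close> and \<open>u - v\<close> would be a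
  nonzero \<open>w\<close> with \<open>w \<oplus> w\<close> below \<open>u\<close>, and
  \<open>w\<close> would have greater order than \<open>u\<close>.\<close>

lemma ex_atom:
  obtains u where "u \<in> carrier A" "u \<noteq> mv_zero A"
    "\<And>x. x \<in> carrier A \<Longrightarrow> x \<noteq> mv_zero A \<Longrightarrow> u \<preceq> x"
proof -
  let ?P = "\<lambda>x. x \<in> carrier A \<and> x \<noteq> mv_zero A"
  have "ord x < Suc m" if "?P x" for x
    using that ord_le[OF mul_m_eq_one] by (simp add: less_Suc_eq_le)
  moreover have "?P (mv_one A)" using nontrivial by auto
  ultimately obtain u where u: "?P u" "\<And>x. ?P x \<Longrightarrow> ord x \<le> ord u"
    using ex_has_greatest_nat[of ?P "mv_one A" ord "Suc m"] by blast
  have "u \<preceq> v" if v: "?P v" for v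
  proof (rule ccontr)
    assume nle: "\<not> u \<preceq> v"
    have [simp]: "u \<in> carrier A" "v \<in> carrier A" using u v by auto
    have vu: "v \<preceq> u" using linear[of u v] nle by auto
    define r where "r = u \<odot> N v"
    define w where "w = v \<curlywedge> r"
    have [simp]: "r \<in> carrier A" "w \<in> carrier A" by (simp_all add: r_def w_def)
    have "r \<noteq> mv_zero A" using nle le_iff[of u v] by (simp add: r_def)
    then have w: "w \<noteq> mv_zero A" using meet_eq_zero[of v r] v by (auto simp: w_def)
    have "w \<oplus> w \<preceq> v \<oplus> r" by (auto intro!: oplus_mono meet_le1 meet_le2 simp: w_def)
    then have ww: "w \<oplus> w \<preceq> u" using oplus_diff[OF vu] by (simp add: r_def)
    have le: "ord w \<le> ord u" using u w by auto
    have "ord u \<noteq> 0" using mul_ord[of u] u nontrivial by (metis mul.simps(1))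
    then obtain k where k: "ord u = Suc k" using not0_implies_Suc by blast
    show False
    \<comment> \<open>The bound \<open>Suc k \<le> 2 * k\<close> requires \<open>k > 0\<close>, so
      order 1 is treated separately.\<close>
    proof (cases "k = 0")
      case True
      then have "ord w \<le> 1" using le k by simp
      then have "mul 1 w = mv_one A"
        using mul_mono[of w "ord w" 1] mul_ord[of w] w le_antisym[OF le_one] by simp
      then have "w = mv_one A" by simp
      moreover have "w \<preceq> v" by (simp add: w_def meet_le1)
      ultimately have "v = mv_one A" by (simp add: le_antisym)
      then show False using nle by simp
    next
      case False
      have "mul (2 * k) w \<preceq> mul k u"
        using mul_mono_arg[OF ww, of k] mul_double[of w k] by simp
      moreover have "mul (Suc k) w \<preceq> mul (2 * k) w"
        using False by (intro mul_mono) auto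
      moreover have "mul (ord w) w \<preceq> mul (Suc k) w"
        using le k by (intro mul_mono) auto
      ultimately have "mul (ord w) w \<preceq> mul k u"
        using le_trans by blast
      then have "mul k u = mv_one A"
        using mul_ord[of w] w le_antisym[OF le_one] by simp
      then show False using ord_le[of k u] k by simp
    qed
  qed
  then show thesis using that u by blast
qed

text \<open>The elements are the distinct multiples of the atom with index at most its order
  \<open>d\<close>. On indices the sum is addition cut off at \<open>d\<close> and the product is
  \<open>j + k - d\<close> cut off at 0, so dividing the index by \<open>d\<close> is an
  isomorphism.\<close>

theorem ex_iso_L_plus:
  obtains d h where "1 \<le> d" "d \<le> m" "h \<in> mv_hom A (L_plus d)"
    "bij_betw h (carrier A) (carrier (L_plus d))"
proof -
  obtain u where u [simp]: "u \<in> carrier A" "u \<noteq> mv_zero A"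
    and atom: "\<And>x. x \<in> carrier A \<Longrightarrow> x \<noteq> mv_zero A \<Longrightarrow> u \<preceq> x"
    using ex_atom by blast
  define d where "d = ord u"
  have d: "mul d u = mv_one A" by (simp add: d_def mul_ord)
  have top: "mul k u = mv_one A" if "d \<le> k" for k
    using mul_mono[OF u(1) that] d by (simp add: le_antisym)
  have lt: "mul k u \<noteq> mv_one A" if "k < d" for k
    using ord_le[of k u] that by (auto simp: d_def)
  have d1: "1 \<le> d" using d nontrivial by (cases d) auto
  have dm: "d \<le> m" unfolding d_def by (intro ord_le mul_m_eq_one) auto
  have inj: "inj_on (\<lambda>k. mul k u) {..d}"
  proof (rule linorder_inj_onI')
    fix j k assume *: "j \<in> {..d}" "k \<in> {..d}" "j < k"
    show "mul j u \<noteq> mul k u"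
    proof
      assume "mul j u = mul k u"
      \<comment> \<open>Adding \<open>d - k\<close> copies turns the larger multiple into 1, while
        the index of the smaller one stays below \<open>d\<close>.\<close>
      then have "mul (j + (d - k)) u = mul (k + (d - k)) u" by (simp add: mul_add)
      then show False using * lt[of "j + (d - k)"] d by simp
    qed
  qed
  have surj: "\<exists>k\<le>d. x = mul k u" if [simp]: "x \<in> carrier A" for x
  proof -
    \<comment> \<open>Take the largest multiple of \<open>u\<close> below \<open>x\<close>. A
      nonzero remainder would lie above the atom and leave room for one more copy.\<close>
    have "\<exists>k. k \<le> d \<and> mul k u \<preceq> x \<and> (\<forall>j. j \<le> d \<and> mul j u \<preceq> x \<longrightarrow> j \<le> k)"
      using ex_has_greatest_nat[of "\<lambda>k. k \<le> d \<and> mul k u \<preceq> x" 0 "\<lambda>k. k" "Suc d"] by auto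
    then obtain k where k: "k \<le> d" "mul k u \<preceq> x" "\<And>j. j \<le> d \<Longrightarrow> mul j u \<preceq> x \<Longrightarrow> j \<le> k"
      by blast
    show ?thesis
    proof (cases "k = d")
      case True
      then have "x = mul d u" using k(2) d by (simp add: le_antisym)
      then show ?thesis by blast
    next
      case False
      define r where "r = x \<odot> N (mul k u)"
      have r: "mul k u \<oplus> r = x" "r \<in> carrier A" using oplus_diff[OF k(2)] by (simp_all add: r_def)
      have "r = mv_zero A"
      proof (rule ccontr)
        assume "r \<noteq> mv_zero A"
        then have "u \<preceq> r" using atom r by blast
        then have "mul (Suc k) u \<preceq> x" using oplus_mono[of "mul k u" "mul k u" u r] r by simp
        then show False using k(3)[of "Suc k"] k(1) False by simp
      qed
      then show ?thesis using r k by auto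
    qed
  qed
  have neg: "mul k u \<odot> mul (d - k) u = mv_zero A" if "k \<le> d" for k
  proof -
    \<comment> \<open>The complement is itself a multiple of \<open>u\<close>; as the two sum to 1,
      its index is at least \<open>d - k\<close>.\<close>
    obtain j where j: "j \<le> d" "N (mul k u) = mul j u" using surj[of "N (mul k u)"] by auto
    have "mul (k + j) u = mv_one A" using oplus_neg[of "mul k u"] j by (simp add: mul_add)
    then have "d - k \<le> j" using lt[of "k + j"] by linarith
    then have "mul k u \<odot> mul (d - k) u \<preceq> mul k u \<odot> mul j u"
      by (intro odot_mono mul_mono) auto
    then show ?thesis using odot_neg[of "mul k u"] j by (simp add: le_antisym)
  qed
  have oplus: "mul j u \<oplus> mul k u = mul (min (j + k) d) u" for j k
    using mul_add[of u j k] top[of "j + k"] d by (simp add: min_def)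
  have odot: "mul j u \<odot> mul k u = mul (j + k - d) u" if "j \<le> d" "k \<le> d" for j k
  proof (cases "j + k \<le> d")
    case True
    have "mul j u \<odot> mul k u \<preceq> mul j u \<odot> mul (d - j) u"
      using True by (intro odot_mono mul_mono) auto
    then show ?thesis using neg[OF that(1)] True by (simp add: le_antisym)
  next
    case False
    \<comment> \<open>Since \<open>(d - j) + i = k\<close>, splitting \<open>mul i u\<close> along
      \<open>mul j u\<close> and \<open>mul (d - j) u\<close> leaves
      \<open>mul j u \<odot> mul k u\<close>.\<close>
    define i where "i = j + k - d"
    have "mul (d - j) u \<odot> mul i u \<preceq> mul (d - j) u \<odot> mul (d - (d - j)) u"
      using that by (intro odot_mono mul_mono) (auto simp: i_def)
    then have 1: "mul (d - j) u \<odot> mul i u = mv_zero A"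
      using neg[of "d - j"] by (simp add: le_antisym)
    have 2: "mul (d - j) u \<oplus> mul i u = mul k u"
      using False that by (simp add: mul_add[symmetric] i_def)
    have "mul j u \<oplus> mul (d - j) u = mv_one A"
      using that d by (simp add: mul_add[symmetric])
    then have "(mul j u \<odot> mul k u) \<oplus> mv_zero A = mul i u"
      using split_by_complement(1)[of "mul j u" "mul (d - j) u" "mul i u"] neg[OF that(1)] 1 2 by simp
    then show ?thesis by (simp add: i_def)
  qed
  have join: "mul j u \<curlyvee> mul k u = mul (max j k) u" for j k
    using mul_mono[of u j k] mul_mono[of u k j]
    by (auto simp: max_def le_iff_join join_comm)
  have meet: "mul j u \<curlywedge> mul k u = mul (min j k) u" for j k
    using mul_mono[of u j k] mul_mono[of u k j]
    by (auto simp: min_def le_def meet_comm)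
  define h where "h x = (of_nat (inv_into {..d} (\<lambda>k. mul k u) x) / of_nat d :: rat)" for x
  have h: "h (mul k u) = of_nat k / of_nat d" if "k \<le> d" for k
    using inv_into_f_f[OF inj, of k] that by (simp add: h_def)
  have pos: "(of_nat d :: rat) > 0" using d1 by simp
  have "h \<in> mv_hom A (L_plus d)"
    unfolding mv_hom_def
  proof (intro CollectI conjI ballI)
    show "h \<in> carrier A \<rightarrow> carrier (L_plus d)"
    proof
      fix x assume "x \<in> carrier A"
      then obtain k where "k \<le> d" "x = mul k u" using surj by blast
      then show "h x \<in> carrier (L_plus d)" using h by (auto simp: L_plus_def)
    qed
    show "h (mv_zero A) = mv_zero (L_plus d)" using h[of 0] by (simp add: L_plus_def)
    show "h (mv_one A) = mv_one (L_plus d)" using h[of d] d pos by (simp add: L_plus_def)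
    fix x y assume "x \<in> carrier A" "y \<in> carrier A"
    then obtain j k where jk: "j \<le> d" "k \<le> d" "x = mul j u" "y = mul k u" using surj by metis
    show "h (x \<curlyvee> y) = h x \<curlyvee>\<^bsub>L_plus d\<^esub> h y" "h (x \<curlywedge> y) = h x \<curlywedge>\<^bsub>L_plus d\<^esub> h y"
      using jk pos by (auto simp: join meet h L_plus_def max_def min_def divide_simps)
    show "h (x \<oplus> y) = h x \<oplus>\<^bsub>L_plus d\<^esub> h y"
    proof -
      have "(of_nat (min (j + k) d) :: rat) = min (of_nat j + of_nat k) (of_nat d)"
        by (simp add: of_nat_min)
      then show ?thesis
        using jk pos by (auto simp: oplus h L_plus_def min_def divide_simps)
    qed
    show "h (x \<odot> y) = h x \<odot>\<^bsub>L_plus d\<^esub> h y"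
    proof -
      have "(of_nat (j + k - d) :: rat) = max (of_nat j + of_nat k - of_nat d) 0"
        by (cases "j + k \<le> d") (auto simp: of_nat_diff max_def simp flip: of_nat_add)
      then show ?thesis
        using jk pos by (auto simp: odot h L_plus_def max_def divide_simps)
    qed
  qed
  moreover have "bij_betw h (carrier A) (carrier (L_plus d))"
    unfolding bij_betw_def
  proof
    show "inj_on h (carrier A)"
    proof (rule inj_onI)
      fix x y assume "x \<in> carrier A" "y \<in> carrier A" and eq: "h x = h y"
      then obtain j k where jk: "j \<le> d" "k \<le> d" "x = mul j u" "y = mul k u" using surj by metis
      then show "x = y" using eq pos by (simp add: h)
    qed
    show "h ` carrier A = carrier (L_plus d)"
    proof
      show "h ` carrier A \<subseteq> carrier (L_plus d)"
        using \<open>h \<in> mv_hom A (L_plus d)\<close> by (auto simp: mv_hom_def)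
      show "carrier (L_plus d) \<subseteq> h ` carrier A"
      proof
        fix q assume "q \<in> carrier (L_plus d)"
        then obtain k where "k \<le> d" "q = of_nat k / of_nat d" by (auto simp: L_plus_def)
        then have "q = h (mul k u)" using h by simp
        then show "q \<in> h ` carrier A" by simp
      qed
    qed
  qed
  ultimately show thesis using that d1 dm by blast
qed

end

section \<open>Complements from the threshold terms\<close>

context mv_monoid
begin

text \<open>The thresholds \<open>k - 1\<close> and \<open>k\<close> of the recursion both remain
  negative, so both factors are 1.\<close>

lemma eval_tau_negative:
  assumes "range v \<subseteq> carrier A" "k < 0"
  shows "mv_eval A v (tau n k t) = mv_one A"
  using assms(2)
proof (induction n arbitrary: k)
  case (Suc n)
  have "mv_eval A v t \<in> carrier A"
    by (rule mv_eval_closed) (use assms(1) mv_alg_axioms in auto)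
  then show ?case using Suc by simp
qed simp

text \<open>The threshold \<open>k - 1\<close> is still at least the smaller index, so the first
  factor of the recursion is 0.\<close>

lemma eval_tau_large:
  assumes "range v \<subseteq> carrier A" "k \<ge> int n"
  shows "mv_eval A v (tau n k t) = mv_zero A"
  using assms(2)
proof (induction n arbitrary: k)
  case (Suc n)
  have "mv_eval A v s \<in> carrier A" for s
    by (rule mv_eval_closed) (use assms(1) mv_alg_axioms in auto)
  then show ?case using Suc by simp
qed simp

text \<open>If \<open>n x\<close> ``equals'' the integer \<open>i\<close>, then \<open>(n - 1) x - (i - 1)\<close> is \<open>1 - x\<close>.\<close>

lemma ex_complement:
  assumes idem: "\<And>e. \<lbrakk>e \<in> carrier A; e \<oplus> e = e; e \<odot> e = e\<rbrakk> \<Longrightarrow> e = mv_zero A \<or> e = mv_one A"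
    and nontrivial: "mv_zero A \<noteq> mv_one A" and "0 < n"
    and Phi: "\<And>e. e \<in> Phi n \<Longrightarrow> mv_satisfies A e"
    and x: "x \<in> carrier A"
  shows "\<exists>y. y \<in> carrier A \<and> x \<oplus> y = mv_one A \<and> x \<odot> y = mv_zero A"
proof -
  obtain p where n: "n = Suc p" using \<open>0 < n\<close> gr0_implies_Suc by blast
  define T where "T j k = mv_eval A (\<lambda>_ :: nat. x) (tau j k (Var 0))" for j k
  have v: "range (\<lambda>_ :: nat. x) \<subseteq> carrier A" using x by auto
  have [simp]: "T j k \<in> carrier A" for j k
    unfolding T_def by (rule mv_eval_closed) (use x mv_alg_axioms in auto)
  have step: "T n k = T p (k - 1) \<odot> (x \<oplus> T p k)" for k by (simp add: T_def n)
  have low: "T n k = mv_one A" if "k < 0" for k unfolding T_def by (rule eval_tau_negative[OF v that])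
  have high: "T n k = mv_zero A" if "k \<ge> int n" for k unfolding T_def by (rule eval_tau_large[OF v that])
  \<comment> \<open>Inside the range of \<open>Phi\<close> the equations make the value idempotent;
    outside it the boundary values apply.\<close>
  have two: "T n k = mv_zero A \<or> T n k = mv_one A" for k
  proof (cases "0 \<le> k \<and> k \<le> int n - 1")
    case True
    then have "(Oplus (tau n k (Var 0)) (tau n k (Var 0)), tau n k (Var 0)) \<in> Phi n"
      "(Odot (tau n k (Var 0)) (tau n k (Var 0)), tau n k (Var 0)) \<in> Phi n"
      by (auto simp: Phi_def Let_def)
    note this[THEN Phi, unfolded mv_satisfies_def, rule_format, OF v]
    then have "T n k \<oplus> T n k = T n k" "T n k \<odot> T n k = T n k"
      by (simp_all add: T_def)
    then show ?thesis by (intro idem) auto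
  qed (use low high in auto)
  \<comment> \<open>The first nonnegative threshold at which the value is no longer 1. For
    \<open>i = 0\<close> the preceding value is the one at -1, which is 1.\<close>
  define i where "i = (LEAST i. T n (int i) \<noteq> mv_one A)"
  have "T n (int n) \<noteq> mv_one A" using high nontrivial by simp
  then have "T n (int i) \<noteq> mv_one A" unfolding i_def by (rule LeastI)
  then have i0: "T n (int i) = mv_zero A" using two by blast
  have i1: "T n (int i - 1) = mv_one A"
  proof (cases i)
    case (Suc j)
    then show ?thesis using not_less_Least[of j "\<lambda>i. T n (int i) \<noteq> mv_one A"] by (simp add: i_def)
  qed (use low in simp)
  define y where "y = T p (int i - 1)"
  have [simp]: "y \<in> carrier A" by (simp add: y_def)
  \<comment> \<open>In the recursion \<open>y\<close> occurs in the second factor at threshold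
    \<open>i - 1\<close> and is the first factor at threshold \<open>i\<close>; the values 1 and 0
    there yield the two complement laws.\<close>
  have "T n (int i - 1) \<preceq> x \<oplus> y"
    using x by (simp add: step y_def odot_le2)
  then have "x \<oplus> y = mv_one A" using i1 x by (simp add: le_antisym)
  moreover have "y \<odot> x \<preceq> T n (int i)"
    unfolding step y_def using x by (intro odot_mono le_oplus1) auto
  then have "x \<odot> y = mv_zero A" using i0 x by (simp add: le_antisym odot_comm)
  ultimately show ?thesis by (intro exI[of _ y]) simp
qed

end

section \<open>Evaluation in finite chains\<close>

lemma carrier_L_plusE:
  assumes "x \<in> carrier (L_plus n)"
  obtains i where "i \<le> n" "x = of_nat i / of_nat n"
  using assms by (auto simp: L_plus_def)

lemma carrier_L_plus_bounds:
  assumes "x \<in> carrier (L_plus n)"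
  shows "0 \<le> x" "x \<le> 1"
  using assms by (auto elim!: carrier_L_plusE simp: divide_le_eq_1)

lemma mv_alg_L_plus:
  assumes "0 < n"
  shows "mv_alg (L_plus n)"
proof
  have pos: "(of_nat n :: rat) > 0" using assms by simp
  show "mv_zero (L_plus n) \<in> carrier (L_plus n)" by (auto simp: L_plus_def intro: exI[of _ 0])
  show "mv_one (L_plus n) \<in> carrier (L_plus n)"
    using pos by (auto simp: L_plus_def intro!: exI[of _ n])
  fix x y assume xy: "x \<in> carrier (L_plus n)" "y \<in> carrier (L_plus n)"
  then show "mv_join (L_plus n) x y \<in> carrier (L_plus n)" "mv_meet (L_plus n) x y \<in> carrier (L_plus n)"
    by (auto simp: L_plus_def max_def min_def)
  from xy obtain i j where ij: "i \<le> n" "x = of_nat i / of_nat n" "j \<le> n" "y = of_nat j / of_nat n"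
    by (meson carrier_L_plusE)
  have xy: "x + y = of_nat (i + j) / of_nat n"
    using ij by (simp add: add_divide_distrib)
  have "min (x + y) 1 = of_nat (min (i + j) n) / of_nat n"
    unfolding xy using pos by (simp add: min_def divide_le_eq_1 del: of_nat_add)
  moreover have "max (x + y - 1) 0 = of_nat (i + j - n) / of_nat n"
    unfolding xy using pos
    by (cases "i + j \<le> n") (simp_all add: max_def divide_simps of_nat_diff del: of_nat_add)
  ultimately show "mv_oplus (L_plus n) x y \<in> carrier (L_plus n)"
    "mv_odot (L_plus n) x y \<in> carrier (L_plus n)"
    using ij by (auto simp: L_plus_def min_def)
qed

lemma mv_monoid_L_plus:
  assumes "0 < n"
  shows "mv_monoid (L_plus n)"
proof -
  interpret mv_alg "L_plus n" using assms by (rule mv_alg_L_plus)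
  have b: "0 \<le> x \<and> x \<le> 1" if "x \<in> carrier (L_plus n)" for x
    using carrier_L_plus_bounds[OF that] by simp
  have ops: "mv_join (L_plus n) = max" "mv_meet (L_plus n) = min"
    "mv_oplus (L_plus n) = (\<lambda>x y. min (x + y) 1)" "mv_odot (L_plus n) = (\<lambda>x y. max (x + y - 1) 0)"
    "mv_zero (L_plus n) = 0" "mv_one (L_plus n) = 1"
    by (auto simp: L_plus_def)
  note cl = zero_closed one_closed oplus_closed odot_closed
  show ?thesis
  proof (intro mv_monoid.intro mv_bounded_distrib_lattice.intro mv_bounded_distrib_lattice_axioms.intro
      mv_monoid_axioms.intro mv_alg_axioms)
    show "comm_monoid \<lparr>carrier = carrier (L_plus n), mult = mv_oplus (L_plus n), one = mv_zero (L_plus n)\<rparr>"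
      by (rule comm_monoidI) (use cl in \<open>simp_all add: ops\<close>, (auto dest!: b simp: min_def; fail)+)
    show "comm_monoid \<lparr>carrier = carrier (L_plus n), mult = mv_odot (L_plus n), one = mv_one (L_plus n)\<rparr>"
      by (rule comm_monoidI) (use cl in \<open>simp_all add: ops\<close>, (auto dest!: b simp: max_def; fail)+)
  qed (simp_all add: ops, (auto dest!: b simp: min_def max_def; fail)+)
qed

lemma L_plus_ops:
  "mv_oplus (L_plus n) x y = min (x + y) 1" "mv_odot (L_plus n) x y = max (x + y - 1) 0"
  "mv_zero (L_plus n) = 0" "mv_one (L_plus n) = 1"
  by (simp_all add: L_plus_def)

lemma eval_L_plus_times:
  assumes "0 \<le> mv_eval (L_plus n) v t" "mv_eval (L_plus n) v t \<le> 1"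
  shows "mv_eval (L_plus n) v (mv_times k t) = min (of_nat k * mv_eval (L_plus n) v t) 1"
proof (induction k)
  case (Suc k)
  show ?case
  proof (cases "k = 0")
    case False
    then show ?thesis using Suc assms by (auto simp: L_plus_ops min_def algebra_simps)
  qed (use assms in simp)
qed (simp add: L_plus_ops)

lemma eval_L_plus_power:
  assumes "0 \<le> mv_eval (L_plus n) v t" "mv_eval (L_plus n) v t \<le> 1"
  shows "mv_eval (L_plus n) v (mv_power t k) =
    max (of_nat k * mv_eval (L_plus n) v t - (of_nat k - 1)) 0"
proof (induction k)
  case (Suc k)
  show ?case
  proof (cases "k = 0")
    case False
    then show ?thesis using Suc assms by (auto simp: L_plus_ops max_def algebra_simps)
  qed (use assms in simp)
qed (simp add: L_plus_ops)

lemma eval_L_plus_tau: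
  assumes "0 \<le> mv_eval (L_plus n) v t" "mv_eval (L_plus n) v t \<le> 1"
  shows "mv_eval (L_plus n) v (tau N k t) =
    max 0 (min 1 (of_nat N * mv_eval (L_plus n) v t - of_int k))"
proof (induction N arbitrary: k)
  case 0
  show ?case
  proof (cases "k \<le> - 1")
    case True
    then have "(of_int k :: rat) \<le> of_int (- 1)" by (simp only: of_int_le_iff)
    then show ?thesis using True by (simp add: L_plus_ops)
  next
    case False
    then have "(of_int k :: rat) \<ge> 0" by simp
    then show ?thesis using False by (simp add: L_plus_ops)
  qed
next
  case (Suc N)
  define x where "x = mv_eval (L_plus n) v t"
  define a where "a = of_nat N * x - of_int k"
  have x: "0 \<le> x" "x \<le> 1" using assms by (simp_all add: x_def)
  \<comment> \<open>One step of the recursion for \<open>a = N x - k\<close>: the truncations of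
    \<open>a + 1\<close> and \<open>a\<close> to the unit interval combine to that of
    \<open>a + x\<close>.\<close>
  have clamp: "max (max 0 (min 1 (a + 1)) + min (x + max 0 (min 1 a)) 1 - 1) 0 = max 0 (min 1 (a + x))"
  proof -
    consider "a \<le> - 1" | "- 1 < a" "a \<le> 0" | "0 < a" by linarith
    then show ?thesis
    proof cases
      case 2
      then have "min 1 (a + 1) = a + 1" "min 1 a = a" "max 0 a = 0" "max 0 (a + 1) = a + 1" by auto
      then show ?thesis using 2 x by (auto simp: algebra_simps)
    qed (use x in \<open>simp_all add: max_def min_def\<close>)
  qed
  have a: "of_nat N * x - of_int (k - 1) = a + 1" "of_nat (Suc N) * x - of_int k = a + x"
    by (simp_all add: a_def algebra_simps)
  show ?case
    by (simp only: tau.simps mv_eval.simps L_plus_ops Suc x_def[symmetric] a a_def[symmetric] clamp)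
qed

text \<open>Since \<open>n\<close> divides \<open>N\<close>, the number \<open>N x - k\<close> is an
  integer on the chain, and its truncation to the unit interval is 0 or 1.\<close>

lemma L_plus_satisfies_Phi:
  assumes "0 < n" "n dvd N" "e \<in> Phi N"
  shows "mv_satisfies (L_plus n) e"
  unfolding mv_satisfies_def
proof (intro allI impI)
  fix v :: "nat \<Rightarrow> rat" assume v: "range v \<subseteq> carrier (L_plus n)"
  then have v0: "v 0 \<in> carrier (L_plus n)" by auto
  then obtain i where i: "i \<le> n" "v 0 = of_nat i / of_nat n" by (rule carrier_L_plusE)
  obtain c where c: "N = n * c" using assms(2) by blast
  obtain k where e: "e = (Oplus (tau N k (Var 0)) (tau N k (Var 0)), tau N k (Var 0)) \<or>
      e = (Odot (tau N k (Var 0)) (tau N k (Var 0)), tau N k (Var 0))"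
    using assms(3) by (auto simp: Phi_def Let_def)
  have "of_nat N * v 0 - of_int k = of_int (int (c * i) - k)"
    using \<open>0 < n\<close> i by (simp add: c)
  then have "mv_eval (L_plus n) v (tau N k (Var 0)) = max 0 (min 1 (of_int (int (c * i) - k)))"
    using eval_L_plus_tau[of n v "Var 0" N k] carrier_L_plus_bounds[OF v0] by simp
  moreover have "max 0 (min 1 (of_int z)) \<in> {0, 1 :: rat}" for z
    by (cases "z \<le> 0") (auto simp: max_def min_def)
  ultimately have "mv_eval (L_plus n) v (tau N k (Var 0)) \<in> {0, 1}" by metis
  then show "mv_eval (L_plus n) v (fst e) = mv_eval (L_plus n) v (snd e)"
    using e by (auto simp: L_plus_ops)
qed

lemma divisor_closed_finite_Max:
  assumes "divisor_closed_finite I" "n \<in> I"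
  shows "0 < n" "n \<le> Max I"
  using assms by (auto simp: divisor_closed_finite_def intro: Nat.gr0I)

text \<open>The first equation holds since nonzero elements are at least \<open>1 / m\<close>. In
  the others both sides are 0 if \<open>k x < 1\<close> and 1 if \<open>k x > 1\<close>; the
  borderline \<open>k x = 1\<close> would make \<open>k\<close> a divisor of \<open>n\<close>, hence
  a member of \<open>I\<close>.\<close>

lemma L_plus_satisfies_Sigma:
  assumes I: "divisor_closed_finite I" "n \<in> I" and e: "e \<in> Sigma_eqs I"
  shows "mv_satisfies (L_plus n) e"
  unfolding mv_satisfies_def
proof (intro allI impI)
  fix v :: "nat \<Rightarrow> rat" assume v: "range v \<subseteq> carrier (L_plus n)"
  then have v0: "v 0 \<in> carrier (L_plus n)" by auto
  then obtain i where i: "i \<le> n" "v 0 = of_nat i / of_nat n" by (rule carrier_L_plusE)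
  define m where "m = Max I"
  define x where "x = v 0"
  have nm: "0 < n" "n \<le> m" using divisor_closed_finite_Max[OF I] by (auto simp: m_def)
  then have n0: "(0 :: rat) < of_nat n" and m0: "(0 :: rat) < of_nat m" and
    nm': "(of_nat n :: rat) \<le> of_nat m" by auto
  have b: "0 \<le> x" "x \<le> 1" using carrier_L_plus_bounds[OF v0] by (auto simp: x_def)
  have times: "mv_eval (L_plus n) v (mv_times k t) = min (of_nat k * mv_eval (L_plus n) v t) 1"
    if "0 \<le> mv_eval (L_plus n) v t \<and> mv_eval (L_plus n) v t \<le> 1" for k t
    using that eval_L_plus_times by blast
  have power: "mv_eval (L_plus n) v (mv_power t k) =
      max (of_nat k * mv_eval (L_plus n) v t - (of_nat k - 1)) 0"
    if "0 \<le> mv_eval (L_plus n) v t \<and> mv_eval (L_plus n) v t \<le> 1" for k t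
    using that eval_L_plus_power by blast
  \<comment> \<open>Positive multiples of \<open>1 / n\<close> are at least \<open>1 / m\<close>;
    thus \<open>k x\<close> stays that far from 1 unless it equals 1.\<close>
  have frac: "1 / of_nat m \<le> of_nat j / (of_nat n :: rat)" if "0 < j" for j
  proof -
    have "(1 :: rat) \<le> of_nat j" using that by simp
    then have "1 / of_nat m \<le> (1 :: rat) / of_nat n" "(1 :: rat) / of_nat n \<le> of_nat j / of_nat n"
      using n0 nm' by (auto intro: divide_left_mono divide_right_mono)
    then show ?thesis by simp
  qed
  have "I \<noteq> {}" using I(2) by blast
  with e consider "e = (mv_times (m + 1) (Var 0), mv_times m (Var 0))"
    | k where "e = (mv_times m (mv_power (mv_times (k - 1) (Var 0)) k), mv_power (mv_times k (Var 0)) m)"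
      "1 \<le> k" "k \<notin> I"
    by (auto simp: Sigma_eqs_def Let_def m_def)
  then show "mv_eval (L_plus n) v (fst e) = mv_eval (L_plus n) v (snd e)"
  proof cases
    case 1
    have "min (of_nat (m + 1) * x) 1 = min (of_nat m * x) 1"
    proof (cases "i = 0")
      case False
      then have "1 / of_nat m \<le> x" using frac[of i] i by (simp add: x_def)
      then have "1 \<le> of_nat m * x" using m0 by (simp add: divide_le_eq mult.commute)
      then show ?thesis using b by (simp add: algebra_simps min_def)
    qed (simp add: x_def i)
    then show ?thesis
      using 1 b times[of "Var 0" "m + 1"] times[of "Var 0" m] by (simp add: x_def del: mv_times.simps)
  next
    case (2 k)
    have k1: "of_nat (k - 1) = (of_nat k - 1 :: rat)" using 2(2) by (simp add: of_nat_diff)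
    have "(1 :: rat) \<le> of_nat k" using 2(2) by simp
    define y where "y = min (of_nat (k - 1) * x) 1"
    define z where "z = max (of_nat k * y - (of_nat k - 1)) 0"
    define w where "w = min (of_nat k * x) 1"
    have yb: "0 \<le> y" "y \<le> 1" using b by (auto simp: y_def)
    have "of_nat k * y \<le> of_nat k" using yb mult_left_mono[of y 1 "of_nat k"] by simp
    then have zb: "0 \<le> z" "z \<le> 1" by (auto simp: z_def)
    have wb: "0 \<le> w" "w \<le> 1" using b by (auto simp: w_def)
    have y: "mv_eval (L_plus n) v (mv_times (k - 1) (Var 0)) = y"
      using times[of "Var 0" "k - 1"] b by (simp add: y_def x_def)
    have z: "mv_eval (L_plus n) v (mv_power (mv_times (k - 1) (Var 0)) k) = z"
      using power[of "mv_times (k - 1) (Var 0)" k] y yb by (simp add: z_def)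
    have w: "mv_eval (L_plus n) v (mv_times k (Var 0)) = w"
      using times[of "Var 0" k] b by (simp add: w_def x_def)
    have "min (of_nat m * z) 1 = max (of_nat m * w - (of_nat m - 1)) 0"
    proof (cases "1 \<le> of_nat (k - 1) * x")
      case True
      then have "y = 1" unfolding y_def by (rule min.absorb2)
      then have "z = 1" by (simp add: z_def)
      moreover have "1 \<le> of_nat k * x" using True[unfolded k1] b by (simp add: algebra_simps)
      then have "w = 1" by (simp add: w_def)
      moreover have "(1 :: rat) \<le> of_nat m" using nm by simp
      ultimately show ?thesis by simp
    next
      case False
      then have y': "y = (of_nat k - 1) * x" unfolding y_def k1 by simp
      \<comment> \<open>In factored form, the sign of \<open>k x - 1\<close> decides whether the
        power vanishes.\<close>
      have z': "z = max ((of_nat k - 1) * (of_nat k * x - 1)) 0"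
        by (simp add: z_def y' algebra_simps)
      have kx: "of_nat k * x = of_nat (k * i) / of_nat n" by (simp add: x_def i)
      consider "k * i < n" | "k * i = n" | "n < k * i" by linarith
      then show ?thesis
      proof cases
        case 1
        then have "of_nat k * x \<le> 1"
          using n0 unfolding kx by (simp add: divide_le_eq_1 del: of_nat_mult)
        then have w: "w = of_nat k * x" and "(of_nat k - 1) * (of_nat k * x - 1) \<le> 0"
          using \<open>(1 :: rat) \<le> of_nat k\<close> by (auto simp: w_def intro: mult_nonneg_nonpos)
        then have "z = 0" unfolding z' by (intro max.absorb2)
        have "of_nat k * x + 1 / of_nat m \<le> 1"
        proof -
          have eq: "of_nat (k * i) + of_nat (n - k * i) = (of_nat n :: rat)"
            using 1 by (simp flip: of_nat_add)
          have "of_nat (k * i) / of_nat n + of_nat (n - k * i) / (of_nat n :: rat) = 1"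
            using n0 unfolding add_divide_distrib[symmetric] eq by simp
          then show ?thesis using frac[of "n - k * i"] 1 unfolding kx by linarith
        qed
        then have "of_nat m * (of_nat k * x + 1 / of_nat m) \<le> of_nat m * 1"
          using m0 by (intro mult_left_mono) auto
        then have "of_nat m * (of_nat k * x) - (of_nat m - 1) \<le> 0"
          using m0 by (simp add: distrib_left)
        then show ?thesis using w \<open>z = 0\<close> by simp
      next
        case 2
        then have "k dvd n" by (metis dvd_triv_left)
        then show ?thesis using I \<open>k \<notin> I\<close> by (auto simp: divisor_closed_finite_def)
      next
        case 3
        then have gt: "1 / of_nat m \<le> of_nat k * x - 1"
        proof -
          have eq: "(of_nat (k * i) :: rat) = of_nat n + of_nat (k * i - n)"
            using 3 by (simp flip: of_nat_add)
          have "of_nat k * x = 1 + of_nat (k * i - n) / (of_nat n :: rat)"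
            using n0 unfolding kx eq add_divide_distrib by simp
          then show ?thesis using frac[of "k * i - n"] 3 by linarith
        qed
        then have kx1: "1 \<le> of_nat k * x" using m0 divide_pos_pos[of 1 "of_nat m :: rat"] by linarith
        then have "w = 1" by (simp add: w_def)
        \<comment> \<open>For \<open>k = 1\<close> the factor \<open>k - 1\<close> would vanish, but
          \<open>k i > n \<ge> i\<close> excludes this.\<close>
        have "k \<noteq> 1" using 3 i by auto
        then have "2 \<le> k" using \<open>1 \<le> k\<close> by simp
        then have "(2 :: rat) \<le> of_nat k" using of_nat_le_iff[of 2 k, where 'a = rat] by simp
        then have "1 * (of_nat k * x - 1) \<le> (of_nat k - 1) * (of_nat k * x - 1)"
          using kx1 by (intro mult_right_mono) auto
        then have "1 / of_nat m \<le> z" using gt by (simp add: z')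
        then have "1 \<le> of_nat m * z" using m0 by (simp add: divide_le_eq mult.commute)
        moreover have "(1 :: rat) \<le> of_nat m" using nm by simp
        ultimately show ?thesis using \<open>w = 1\<close> by simp
      qed
    qed
    moreover have "mv_eval (L_plus n) v (fst e) = min (of_nat m * z) 1"
      using times[of "mv_power (mv_times (k - 1) (Var 0)) k" m] 2 z zb by simp
    moreover have "mv_eval (L_plus n) v (snd e) = max (of_nat m * w - (of_nat m - 1)) 0"
      using power[of "mv_times k (Var 0)" m] 2 w wb by simp
    ultimately show ?thesis by simp
  qed
qed

text \<open>The equation of \<open>\<Sigma>\<^sub>I\<close> for \<open>k = d\<close> fails in \<open>L_plus d\<close> at \<open>1 / d\<close>.\<close>

lemma mem_if_L_plus_satisfies_Sigma:
  assumes "1 \<le> d" "d \<le> Max I" "I \<noteq> {}" and sat: "\<And>e. e \<in> Sigma_eqs I \<Longrightarrow> mv_satisfies (L_plus d) e"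
  shows "d \<in> I"
proof (rule ccontr)
  assume "d \<notin> I"
  define m where "m = Max I"
  let ?x = "Var 0 :: nat mv_term"
  let ?l = "mv_times m (mv_power (mv_times (d - 1) ?x) d)" and ?r = "mv_power (mv_times d ?x) m"
  let ?v = "\<lambda>_ :: nat. 1 / of_nat d :: rat"
  have d0: "(0 :: rat) < of_nat d" and d1: "of_nat (d - 1) = (of_nat d - 1 :: rat)" and "(1 :: rat) \<le> of_nat d"
    using assms(1) by (auto simp: of_nat_diff)
  have "(?l, ?r) \<in> Sigma_eqs I"
    using assms \<open>d \<notin> I\<close> unfolding Sigma_eqs_def Let_def m_def by auto
  moreover have "range ?v \<subseteq> carrier (L_plus d)"
    using assms(1) by (auto simp: L_plus_def intro!: exI[of _ 1])
  ultimately have eq: "mv_eval (L_plus d) ?v ?l = mv_eval (L_plus d) ?v ?r"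
    using sat unfolding mv_satisfies_def by fastforce
  have x: "0 \<le> mv_eval (L_plus d) ?v ?x" "mv_eval (L_plus d) ?v ?x \<le> 1"
    using \<open>1 \<le> of_nat d\<close> by auto
  have y: "mv_eval (L_plus d) ?v (mv_times (d - 1) ?x) = (of_nat d - 1) / of_nat d"
    using eval_L_plus_times[OF x, of "d - 1"] d0 d1 by (simp add: min_def divide_le_eq_1)
  \<comment> \<open>The \<open>d\<close>-th power of \<open>(d - 1) / d\<close> is exactly 0, while
    \<open>d\<close> copies of \<open>1 / d\<close> sum to exactly 1; this separates the two
    sides.\<close>
  have z: "mv_eval (L_plus d) ?v (mv_power (mv_times (d - 1) ?x) d) = 0"
    using eval_L_plus_power[of d ?v "mv_times (d - 1) ?x" d, unfolded y] d0 \<open>1 \<le> of_nat d\<close>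
    by (simp add: divide_le_eq_1)
  have w: "mv_eval (L_plus d) ?v (mv_times d ?x) = 1"
    using eval_L_plus_times[OF x, of d] d0 by simp
  have "mv_eval (L_plus d) ?v ?l = 0"
    using eval_L_plus_times[of d ?v "mv_power (mv_times (d - 1) ?x) d" m, unfolded z] by simp
  moreover have "mv_eval (L_plus d) ?v ?r = 1"
    using eval_L_plus_power[of d ?v "mv_times d ?x" m, unfolded w] by simp
  ultimately show False using eq by simp
qed

section \<open>Axiomatization of the generated variety\<close>

text \<open>Such an algebra is isomorphic to some \<open>L_plus d\<close>. As
  \<open>Sigma_eqs I\<close> transfers to the chain, \<open>d\<close> lies in \<open>I\<close>, and
  the equation of the chains returns along the isomorphism.\<close>

lemma simple_satisfies:
  fixes I :: "nat set"
  assumes I: "divisor_closed_finite I" and A: "mv_monoid A" and nontrivial: "mv_zero A \<noteq> mv_one A"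
    and idem: "\<And>e. \<lbrakk>e \<in> carrier A; mv_oplus A e e = e; mv_odot A e e = e\<rbrakk> \<Longrightarrow> e = mv_zero A \<or> e = mv_one A"
    and Phi: "\<And>e. e \<in> Phi (Lcm I) \<Longrightarrow> mv_satisfies A e"
    and Sigma: "\<And>e. e \<in> Sigma_eqs I \<Longrightarrow> mv_satisfies A e"
    and e: "\<And>n. n \<in> I \<Longrightarrow> mv_satisfies (L_plus n) e"
  shows "mv_satisfies A e"
proof -
  interpret mv_monoid A by fact
  have alg: "mv_alg A" by unfold_locales
  define m where "m = (if I = {} then 0 else Max I)"
  have "finite I" "0 \<notin> I" using I by (auto simp: divisor_closed_finite_def)
  then have Lcm: "0 < Lcm I" by (simp add: Lcm_0_iff_nat zero_less_iff_neq_zero Lcm_0_iff)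
  define N where "N x = (SOME y. y \<in> carrier A \<and> mv_oplus A x y = mv_one A \<and> mv_odot A x y = mv_zero A)" for x
  have N: "N x \<in> carrier A \<and> mv_oplus A x (N x) = mv_one A \<and> mv_odot A x (N x) = mv_zero A" if "x \<in> carrier A" for x
    unfolding N_def by (rule someI_ex, rule ex_complement[OF idem nontrivial Lcm Phi that])
  have mul: "mul (Suc m) x = mul m x" if x: "x \<in> carrier A" for x
  proof -
    have "(mv_times (m + 1) (Var 0), mv_times m (Var 0)) \<in> Sigma_eqs I"
      by (simp add: Sigma_eqs_def Let_def m_def)
    from Sigma[OF this, unfolded mv_satisfies_def, rule_format, of "\<lambda>_. x"] x
    have "mv_eval A (\<lambda>_ :: nat. x) (mv_times (Suc m) (Var 0)) = mv_eval A (\<lambda>_ :: nat. x) (mv_times m (Var 0))"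
      by (simp del: mv_times.simps)
    then show ?thesis using x by (simp add: eval_mv_times del: mv_times.simps)
  qed
  interpret mv_simple A N m
  proof (unfold_locales, goal_cases)
    case (5 x)
    then show ?case by (rule idem)
  qed (simp_all add: N nontrivial mul del: mul.simps)
  obtain d h where d: "1 \<le> d" "d \<le> m" and h: "h \<in> mv_hom A (L_plus d)"
    "bij_betw h (carrier A) (carrier (L_plus d))"
    by (rule ex_iso_L_plus)
  then have inj: "inj_on h (carrier A)" and surj: "h ` carrier A = carrier (L_plus d)"
    by (auto simp: bij_betw_def)
  \<comment> \<open>For empty \<open>I\<close> the bound \<open>m\<close> would be 0, contradicting
    \<open>1 \<le> d \<le> m\<close>.\<close>
  have "I \<noteq> {}" using d by (auto simp: m_def)
  then have "d \<in> I"
    using d mv_satisfies_surj_hom[OF alg h(1) surj Sigma]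
    by (intro mem_if_L_plus_satisfies_Sigma) (auto simp: m_def)
  then show ?thesis using mv_satisfies_inj_hom[OF alg h(1) inj e] by blast
qed

theorem theorem8p18:
  fixes I :: "nat set"
  assumes "divisor_closed_finite I"
  shows "(generated_variety (K_class I) :: 'a mv_struct set) =
    {A. mv_monoid A \<and> (\<forall>e \<in> Phi (Lcm I) \<union> Sigma_eqs I. mv_satisfies A e)}"
proof -
  have pos: "0 < n" if "n \<in> I" for n using divisor_closed_finite_Max[OF assms that] by simp
  have variety: "(generated_variety (K_class I) :: 'a mv_struct set) =
      {A. mv_alg A \<and> (\<forall>e. (\<forall>n\<in>I. mv_satisfies (L_plus n) e) \<longrightarrow> mv_satisfies A e)}"
    using mv_alg_L_plus pos by (subst generated_variety_eq_Mod_Th) (auto simp: K_class_def)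
  show ?thesis
    unfolding variety
  proof (intro equalityI subsetI CollectI conjI allI impI ballI)
    fix A :: "'a mv_struct"
    assume "A \<in> {A. mv_alg A \<and> (\<forall>e. (\<forall>n\<in>I. mv_satisfies (L_plus n) e) \<longrightarrow> mv_satisfies A e)}"
    then have A: "mv_alg A" "\<And>e. (\<And>n. n \<in> I \<Longrightarrow> mv_satisfies (L_plus n) e) \<Longrightarrow> mv_satisfies A e"
      by blast+
    \<comment> \<open>The MV-monoid axioms are themselves equations valid in every chain of the
      class.\<close>
    show "mv_monoid A"
      unfolding mv_monoid_iff_eqs
      using A mv_monoid.satisfies_mv_monoid_eqs[OF mv_monoid_L_plus[OF pos]] by blast
    show "mv_satisfies A e" if "e \<in> Phi (Lcm I) \<union> Sigma_eqs I" for e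
      using that L_plus_satisfies_Phi[OF pos dvd_Lcm] L_plus_satisfies_Sigma[OF assms]
      by (intro A(2)) blast
  next
    fix A :: "'a mv_struct"
    assume "A \<in> {A. mv_monoid A \<and> (\<forall>e\<in>Phi (Lcm I) \<union> Sigma_eqs I. mv_satisfies A e)}"
    then have A: "mv_monoid A" and eqs: "\<And>e. e \<in> Phi (Lcm I) \<union> Sigma_eqs I \<Longrightarrow> mv_satisfies A e"
      by blast+
    interpret mv_monoid A by fact
    show alg: "mv_alg A" by unfold_locales
    fix e assume e: "\<forall>n\<in>I. mv_satisfies (L_plus n) e"
    show "mv_satisfies A e"
      unfolding mv_satisfies_def
    proof (intro allI impI, rule ccontr)
      fix v assume v: "range v \<subseteq> carrier A" and ne: "mv_eval A v (fst e) \<noteq> mv_eval A v (snd e)"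
      have ev: "mv_eval A v t \<in> carrier A" for t
        by (rule mv_eval_closed[OF alg]) (use v in auto)
      \<comment> \<open>A maximal congruence keeping the two sides apart preserves the failure and
        leaves only 0 and 1 as idempotents of the quotient.\<close>
      obtain \<theta> where \<theta>: "mv_cong A \<theta>" "(mv_eval A v (fst e), mv_eval A v (snd e)) \<notin> \<theta>"
        "\<And>\<eta>. mv_cong A \<eta> \<Longrightarrow> \<theta> \<subseteq> \<eta> \<Longrightarrow> (mv_eval A v (fst e), mv_eval A v (snd e)) \<notin> \<eta> \<Longrightarrow> \<eta> = \<theta>"
        using ex_maximal_separating_cong[OF alg ne] by blast
      define Q where "Q = mv_quotient A \<theta>"
      interpret Q: mv_monoid Q unfolding Q_def using A \<theta>(1) by (rule mv_monoid_quotient)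
      have Qsat: "mv_satisfies Q e" if "mv_satisfies A e" for e
        unfolding Q_def using alg \<theta>(1) that by (rule quotient_satisfies)
      have hom: "mv_rep \<theta> \<in> mv_hom A Q" unfolding Q_def by (rule mv_rep_hom[OF \<theta>(1) alg])
      have rep_ne: "mv_rep \<theta> (mv_eval A v (fst e)) \<noteq> mv_rep \<theta> (mv_eval A v (snd e))"
        using mv_rep_eq_iff[OF \<theta>(1) ev ev] \<theta>(2) by blast
      have rv: "range (mv_rep \<theta> \<circ> v) \<subseteq> carrier Q"
        using hom v by (auto simp: mv_hom_def)
      have rep: "mv_rep \<theta> (mv_eval A v t) = mv_eval Q (mv_rep \<theta> \<circ> v) t" for t
        by (rule mv_eval_hom[OF alg hom]) (use v in auto)
      \<comment> \<open>If 0 and 1 coincided, \<open>Q\<close> would have a single element and could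
        not separate the two sides.\<close>
      have "mv_zero Q \<noteq> mv_one Q"
      proof
        assume eq: "mv_zero Q = mv_one Q"
        have "x = mv_zero Q" if "x \<in> carrier Q" for x
          using that Q.one_simps(1)[of x] Q.zero_simps(3)[of x] eq by simp
        moreover have "mv_rep \<theta> (mv_eval A v t) \<in> carrier Q" for t
          using hom ev by (auto simp: mv_hom_def)
        ultimately show False using rep_ne by metis
      qed
      then have "mv_satisfies Q e"
        by (rule simple_satisfies[OF assms Q.mv_monoid_axioms])
          (use idempotent_in_maximal_quotient[OF A \<theta> ev ev Q_def] Qsat eqs e in auto)
      then show False using rv rep_ne unfolding rep by (simp add: mv_satisfies_def)
    qed
  qed
qed

end
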